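(* Let $a,b\in\mathbb{R}\setminus\{0\}$, let $\mathcal{C}\subset\mathbb{CP}^2$ be the complex conic with affine equation $\frac{x^2}{a}+\frac{y^2}{b}=1$, and for $\lambda\in\mathbb{C}\setminus\{a,b\}$ let $\mathcal{C}_\lambda$ be the complex conic with affine equation $\frac{x^2}{a-\lambda}+\frac{y^2}{b-\lambda}=1$. Let $n\ge 3$ be an integer and let $\mathcal{N}_{a,b}(n)$ be the number of conics $\mathcal{C}_\lambda$, $\lambda\in\mathbb{C}\setminus\{a,b\}$, which are $n$-caustics of $\mathcal{C}$. There is a polynomial $\mathcal{B}^n_{a,b}(\lambda)$ in $\lambda$ such that: (1) a number $\lambda\in\mathbb{C}\setminus\{a,b\}$ is a root of $\mathcal{B}^n_{a,b}$ if and only if $\mathcal{C}_\lambda$ is an $n$-caustic of $\mathcal{C}$; (2) $\deg\mathcal{B}^n_{a,b}\le \frac{n^2-1}{4}$ if $n$ is odd, and $\deg\mathcal{B}^n_{a,b}\le\frac{n^2}{4}-1$ if $n$ is even; (3) if $\mathcal{B}^n_{a,b}$ has only simple roots, all distinct from $a$ and $b$, then $\mathcal{N}_{a,b}(n)=\deg\mathcal{B}^n_{a,b}$.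
   Context: Use homogeneous coordinates $(x:y:z)$ on $\mathbb{CP}^2$, identify $\mathbb{C}^2$ with $\{z=1\}$, and equip $\mathbb{C}^2$ with the complex quadratic form $q(x,y)=x^2+y^2$. Let $I=(1:i:0)$, $J=(1:-i:0)$. A line is isotropic if it contains $I$ or $J$. If $L$ is a non-isotropic line, the symmetry with respect to $L$ is the unique non-trivial complex affine involution of $\mathbb{C}^2$ preserving $q$ and fixing the points of $L$; it extends to $\mathbb{CP}^2$ and acts on lines. If $L$ is isotropic and different from the line at infinity, and $p\in L$, two lines $\ell,\ell'$ through $p$ are symmetric with respect to $L$ if $(\ell,\ell',L,p)$ is a limit of $(\ell_n,\ell_n',L_n,p_n)$ with $\ell_n,\ell'_n,L_n$ lines through $p_n$, $L_n$ non-isotropic and $\ell_n,\ell_n'$ symmetric with respect to $L_n$. A non-degenerate $n$-periodic orbit on a conic $C$ is a tuple $(p_1,\dots,p_n)\in C^n$ (indices modulo $n$) such that for every $j$: $p_j\neq p_{j+1}$, the tangent line $T_{p_j}C$ is non-isotropic, and the lines $p_{j-1}p_j$ and $p_jp_{j+1}$ are symmetric with respect to $T_{p_j}C$. It is circumscribed about a conic $C'$ if for every $j$ the two tangent lines to $C'$ through $p_j$ are $p_{j-1}p_j$ and $p_jp_{j+1}$ (the two tangent lines coincide when $p_j\in C'$). A conic $C'$ is a complex caustic of $C$ if for every line $\ell$ tangent to $C'$ and every $p\in\ell\cap C$, $\ell$ is reflected into a line tangent to $C'$, i.e. a line through $p$ symmetric to $\ell$ with respect to $T_pC$ is tangent to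 $C'$. Two conics are in general position if they intersect in four distinct points. If $C,C'$ are in general position, $C'$ is an $n$-caustic of $C$ if $C'$ is a complex caustic of $C$ and some (non-degenerate) $n$-periodic orbit of $C$ is circumscribed about $C'$. *)

theory Defs
  imports "HOL-Analysis.Analysis" "HOL-Computational_Algebra.Polynomial"
begin

definition bil :: "complex^3 \<Rightarrow> complex^3 \<Rightarrow> complex" where
  "bil u v = (\<Sum>i\<in>UNIV. u $ i * v $ i)"

definition proportional :: "complex^3 \<Rightarrow> complex^3 \<Rightarrow> bool" where
  "proportional u v \<longleftrightarrow> u \<noteq> 0 \<and> v \<noteq> 0 \<and> (\<exists>c. v = c *s u)"

quotient_type cp2 = "complex^3" / partial: proportional
proof (rule part_equivpI)
  show "\<exists>x. proportional x x"
    by (rule exI[of _ "axis 1 1"]) (auto simp: proportional_def axis_eq_0_iff intro: exI[of _ 1])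
  show "symp proportional"
  proof (rule sympI)
    fix u v assume "proportional u v"
    then obtain c where c: "u \<noteq> 0" "v \<noteq> 0" "v = c *s u" by (auto simp: proportional_def)
    then have "c \<noteq> 0" by auto
    with c have "u = inverse c *s v" by (simp add: vec_eq_iff)
    with c show "proportional v u" unfolding proportional_def by blast
  qed
  show "transp proportional"
    unfolding transp_def proportional_def by (metis vector_smult_assoc)
qed

text \<open>A line of the plane is given by its coefficient vector up to scaling, i.e. it is a point
  of the dual plane; both planes carry the quotient topology defined below.\<close>

type_synonym cline = cp2

definition hcoord :: "complex \<Rightarrow> complex \<Rightarrow> complex \<Rightarrow> cp2" where
  "hcoord x y z = abs_cp2 (vector [x, y, z])"

instantiation cp2 :: topological_space
begin

definition open_cp2 :: "cp2 set \<Rightarrow> bool" where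
  "open_cp2 U \<longleftrightarrow> open {v. v \<noteq> 0 \<and> abs_cp2 v \<in> U}"

instance
proof
  have "{v::complex^3. v \<noteq> 0} = - {0}" by auto
  then show "open (UNIV :: cp2 set)" by (simp add: open_cp2_def open_Compl)
next
  fix S T :: "cp2 set" assume "open S" "open T"
  then have "open ({v. v \<noteq> 0 \<and> abs_cp2 v \<in> S} \<inter> {v. v \<noteq> 0 \<and> abs_cp2 v \<in> T})"
    unfolding open_cp2_def by (rule open_Int)
  moreover have "{v. v \<noteq> 0 \<and> abs_cp2 v \<in> S} \<inter> {v. v \<noteq> 0 \<and> abs_cp2 v \<in> T} =
      {v. v \<noteq> 0 \<and> abs_cp2 v \<in> S \<inter> T}" by auto
  ultimately show "open (S \<inter> T)" by (simp add: open_cp2_def)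
next
  fix K :: "cp2 set set" assume "\<forall>S\<in>K. open S"
  then have "open (\<Union>S\<in>K. {v. v \<noteq> 0 \<and> abs_cp2 v \<in> S})"
    by (intro open_UN) (simp add: open_cp2_def)
  moreover have "(\<Union>S\<in>K. {v. v \<noteq> 0 \<and> abs_cp2 v \<in> S}) = {v. v \<noteq> 0 \<and> abs_cp2 v \<in> \<Union>K}" by auto
  ultimately show "open (\<Union>K)" by (simp add: open_cp2_def)
qed

end

lift_definition incident :: "cp2 \<Rightarrow> cline \<Rightarrow> bool" is "\<lambda>u l. bil u l = 0"
proof -
  have *: "bil (c *s u) (d *s v) = c * d * bil u v" for c d u v
    by (simp add: bil_def sum_distrib_left mult_ac)
  fix u u' l l' assume "proportional u u'" "proportional l l'"
  then obtain c d where "u' = c *s u" "l' = d *s l" "c \<noteq> 0" "d \<noteq> 0"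
    unfolding proportional_def by fastforce
  then show "(bil u l = 0) = (bil u' l' = 0)" by (simp add: *)
qed

definition line_points :: "cline \<Rightarrow> cp2 set" where
  "line_points l = {p. incident p l}"

definition line_through :: "cp2 \<Rightarrow> cp2 \<Rightarrow> cline" where
  "line_through p q = (THE l. incident p l \<and> incident q l)"

definition line_at_infinity :: cline where
  "line_at_infinity = hcoord 0 0 1"

definition isotropic :: "cline \<Rightarrow> bool" where
  "isotropic L \<longleftrightarrow> incident (hcoord 1 \<i> 0) L \<or> incident (hcoord 1 (- \<i>) 0) L"

definition qform :: "complex^2 \<Rightarrow> complex" where
  "qform v = (v $ 1)\<^sup>2 + (v $ 2)\<^sup>2"

definition affine_map :: "complex^2^2 \<Rightarrow> complex^2 \<Rightarrow> complex^2 \<Rightarrow> complex^2" where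
  "affine_map A t v = A *v v + t"

text \<open>An affine map preserves \<^term>\<open>qform\<close> if its linear part does, i.e. if it preserves
  \<^term>\<open>qform\<close> of differences. For a non-isotropic line there is exactly one such map
  (lemma \<open>symmetry_unique_existence\<close>), so \<open>reflected\<close> below may quantify it existentially.\<close>

definition is_symmetry :: "cline \<Rightarrow> complex^2^2 \<Rightarrow> complex^2 \<Rightarrow> bool" where
  "is_symmetry L A t \<longleftrightarrow>
     affine_map A t \<circ> affine_map A t = id \<and> affine_map A t \<noteq> id \<and>
     (\<forall>u v. qform (affine_map A t u - affine_map A t v) = qform (u - v)) \<and>
     (\<forall>v. incident (hcoord (v $ 1) (v $ 2) 1) L \<longrightarrow> affine_map A t v = v)"

lemma hcoord_on_line:
  assumes "m \<noteq> 0" "(x, y, z) \<noteq> (0, 0, 0)"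
  shows "incident (hcoord x y z) (abs_cp2 m) \<longleftrightarrow> x * m $ 1 + y * m $ 2 + z * m $ 3 = 0"
proof -
  have "(vector [x, y, z] :: complex^3) \<noteq> 0"
    using assms(2) by (auto simp: vec_eq_iff forall_3)
  with assms(1) show ?thesis
    unfolding hcoord_def by (subst incident.abs_eq) (auto simp: proportional_def bil_def sum_3 intro: exI[of _ 1])
qed

lemma isotropic_abs_cp2:
  assumes "m \<noteq> 0"
  shows "isotropic (abs_cp2 m) \<longleftrightarrow> (m $ 1)\<^sup>2 + (m $ 2)\<^sup>2 = 0"
proof -
  have "(m $ 1)\<^sup>2 + (m $ 2)\<^sup>2 = (m $ 1 + \<i> * m $ 2) * (m $ 1 - \<i> * m $ 2)"
    by (simp add: algebra_simps power2_eq_square)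
  then show ?thesis by (simp add: isotropic_def hcoord_on_line assms)
qed

lemma symmetry_unique_existence:
  assumes "\<not> isotropic L"
  shows "\<exists>!f. \<exists>A t. f = affine_map A t \<and> is_symmetry L A t"
proof -
  obtain m where m: "m \<noteq> 0" "L = abs_cp2 m"
    by (metis Quotient_cp2 Quotient_abs_rep Quotient_rep_reflp proportional_def)
  define N where "N = (m $ 1)\<^sup>2 + (m $ 2)\<^sup>2"
  have N: "N \<noteq> 0" using assms m by (simp add: isotropic_abs_cp2 N_def)
  define \<alpha> \<beta> \<gamma> where "\<alpha> = m $ 1" and "\<beta> = m $ 2" and "\<gamma> = m $ 3"
  have N': "N = \<alpha>\<^sup>2 + \<beta>\<^sup>2" by (simp add: N_def \<alpha>_def \<beta>_def)
  have inc: "incident (hcoord x y 1) L \<longleftrightarrow> x * \<alpha> + y * \<beta> + \<gamma> = 0" for x y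
    using hcoord_on_line[OF m(1), of x y 1] by (simp add: m(2) \<alpha>_def \<beta>_def \<gamma>_def)
  define A0 :: "complex^2^2" where
    "A0 = vector [vector [1 - 2*\<alpha>*\<alpha>/N, -2*\<alpha>*\<beta>/N], vector [-2*\<alpha>*\<beta>/N, 1 - 2*\<beta>*\<beta>/N]]"
  define t0 :: "complex^2" where "t0 = vector [-2*\<gamma>*\<alpha>/N, -2*\<gamma>*\<beta>/N]"
  have ap: "affine_map A t v = vector [A$1$1 * v$1 + A$1$2 * v$2 + t$1, A$2$1 * v$1 + A$2$2 * v$2 + t$2]"
    for A t v by (simp add: affine_map_def vec_eq_iff forall_2 matrix_vector_mult_def sum_2)
  have e: "affine_map A0 t0 v = vector [v$1 - 2*\<alpha>*(\<alpha>* v$1+\<beta>* v$2+\<gamma>)/N, v$2 - 2*\<beta>*(\<alpha>* v$1+\<beta>* v$2+\<gamma>)/N]" for v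
    using N by (simp add: ap A0_def t0_def field_simps vec_eq_iff forall_2)
  have ex: "is_symmetry L A0 t0"
    unfolding is_symmetry_def
  proof (intro conjI allI impI)
    show "affine_map A0 t0 \<circ> affine_map A0 t0 = id"
    proof
      fix v :: "complex^2"
      have h: "\<alpha>*(v$1 - 2*\<alpha>*k/N) + \<beta>*(v$2 - 2*\<beta>*k/N) + \<gamma> = -k"
        if "k = \<alpha>* v$1+\<beta>* v$2+\<gamma>" for k
      proof -
        have "\<alpha>*(v$1 - 2*\<alpha>*k/N) + \<beta>*(v$2 - 2*\<beta>*k/N) + \<gamma> = k - 2*k*(\<alpha>\<^sup>2+\<beta>\<^sup>2)/N"
          using that by (simp add: field_simps power2_eq_square add_divide_distrib)
        then show ?thesis using N by (simp add: N'[symmetric])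
      qed
      show "(affine_map A0 t0 \<circ> affine_map A0 t0) v = id v"
        using N by (simp add: e h vec_eq_iff forall_2) (simp add: field_simps)
    qed
    show "affine_map A0 t0 \<noteq> id"
    proof
      assume i: "affine_map A0 t0 = id"
      obtain v :: "complex^2" where v: "\<alpha>* v$1+\<beta>* v$2+\<gamma> \<noteq> 0"
      proof (cases "\<gamma> = 0")
        case False then show ?thesis using that[of 0] by simp
      next
        case True
        have "\<alpha> \<noteq> 0 \<or> \<beta> \<noteq> 0" using N N' by auto
        then show ?thesis using that[of "axis 1 1"] that[of "axis 2 1"] True by (auto simp: axis_def)
      qed
      from i have "affine_map A0 t0 v = v" by simp
      then have "\<alpha> = 0 \<and> \<beta> = 0" using v N by (auto simp: e vec_eq_iff forall_2)
      then show False using N N' by simp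
    qed
    show "qform (affine_map A0 t0 u - affine_map A0 t0 v) = qform (u - v)" for u v
    proof -
      define x y where "x = u$1 - v$1" and "y = u$2 - v$2"
      define k where "k = (\<alpha>*x+\<beta>*y)/N"
      have kN: "k * (\<alpha>\<^sup>2+\<beta>\<^sup>2) = \<alpha>*x+\<beta>*y" using N by (simp add: k_def N')
      have "affine_map A0 t0 u - affine_map A0 t0 v = vector [x - 2*\<alpha>*k, y - 2*\<beta>*k]"
        using N by (simp add: e vec_eq_iff forall_2 x_def y_def k_def field_simps)
      moreover have "(x - 2*\<alpha>*k)\<^sup>2 + (y - 2*\<beta>*k)\<^sup>2 = x\<^sup>2 + y\<^sup>2"
        using kN by algebra
      ultimately show ?thesis by (simp add: qform_def x_def y_def)
    qed
    show "affine_map A0 t0 v = v" if "incident (hcoord (v $ 1) (v $ 2) 1) L" for v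
      using that by (simp add: inc e vec_eq_iff forall_2 mult.commute)
  qed
  have un: "f = affine_map A0 t0" if f: "f = affine_map A t" "is_symmetry L A t" for f A t
  proof -
    define p where "p = A$1$1" define r where "r = A$1$2"
    define s where "s = A$2$1" define w where "w = A$2$2"
    define t1 where "t1 = t$1" define t2 where "t2 = t$2"
    note d = p_def r_def s_def w_def t1_def t2_def
    have ff: "affine_map A t (vector [x,y]) = vector [p*x+r*y+t1, s*x+w*y+t2]" for x y
      by (simp add: ap d)
    have fx: "p*x+r*y+t1 = x \<and> s*x+w*y+t2 = y" if "x*\<alpha>+y*\<beta>+\<gamma>=0" for x y
    proof -
      have "affine_map A t (vector [x,y]) = vector [x,y]"
        using f(2) that inc[of x y] by (simp add: is_symmetry_def)
      then show ?thesis by (simp add: ff vec_eq_iff forall_2)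
    qed
    define x0 y0 where "x0 = -\<gamma>*\<alpha>/N" and "y0 = -\<gamma>*\<beta>/N"
    have o: "x0*\<alpha>+y0*\<beta>+\<gamma> = 0"
    proof -
      have "x0*\<alpha>+y0*\<beta>+\<gamma> = \<gamma> - \<gamma>*(\<alpha>\<^sup>2+\<beta>\<^sup>2)/N"
        by (simp add: x0_def y0_def power2_eq_square field_simps add_divide_distrib)
      then show ?thesis using N by (simp add: N'[symmetric])
    qed
    have o2: "(x0+\<beta>)*\<alpha>+(y0-\<alpha>)*\<beta>+\<gamma> = 0" using o by (simp add: algebra_simps)
    note f0 = fx[OF o] and f1 = fx[OF o2]
    have D1: "p*\<beta>-r*\<alpha> = \<beta>"
      using arg_cong2[of _ _ _ _ "(-)", OF f1[THEN conjunct1] f0[THEN conjunct1]]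
      by (simp add: algebra_simps)
    have D2: "s*\<beta>-w*\<alpha> = -\<alpha>"
      using arg_cong2[of _ _ _ _ "(-)", OF f1[THEN conjunct2] f0[THEN conjunct2]]
      by (simp add: algebra_simps)
    note D = D1 D2
    have Q: "(p*x+r*y)\<^sup>2+(s*x+w*y)\<^sup>2 = x\<^sup>2+y\<^sup>2" for x y
    proof -
      have "qform (affine_map A t (vector [x,y]) - affine_map A t (vector [0,0])) = qform (vector [x,y] - vector [0,0])"
        using f(2) unfolding is_symmetry_def by blast
      then show ?thesis by (simp add: ff qform_def)
    qed
    have q1: "p\<^sup>2+s\<^sup>2=1" using Q[of 1 0] by simp
    have q2: "r\<^sup>2+w\<^sup>2=1" using Q[of 0 1] by simp
    have "(p+r)\<^sup>2+(s+w)\<^sup>2 = (p\<^sup>2+s\<^sup>2) + (r\<^sup>2+w\<^sup>2) + 2*(p*r+s*w)"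
      by (simp add: power2_eq_square algebra_simps)
    then have q3: "p*r+s*w=0" using Q[of 1 1] by (simp add: q1 q2 del: distrib_left_numeral)
    define X Y where "X = p*\<alpha>+r*\<beta>" and "Y = s*\<alpha>+w*\<beta>"
    have or: "X*\<beta> - Y*\<alpha> = 0"
    proof -
      have "X*(p*\<beta>-r*\<alpha>) + Y*(s*\<beta>-w*\<alpha>) = 0"
      proof -
        have "X*(p*\<beta>-r*\<alpha>) + Y*(s*\<beta>-w*\<alpha>) =
            \<alpha>*\<beta>*(p\<^sup>2+s\<^sup>2) - \<alpha>*\<beta>*(r\<^sup>2+w\<^sup>2) + (\<beta>\<^sup>2-\<alpha>\<^sup>2)*(p*r+s*w)"
          by (simp add: X_def Y_def power2_eq_square algebra_simps)
        then show ?thesis by (simp add: q1 q2 q3)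
      qed
      then show ?thesis by (simp add: D)
    qed
    have nn: "X\<^sup>2+Y\<^sup>2=N" using Q[of \<alpha> \<beta>] by (simp add: X_def Y_def N')
    define c where "c = (X*\<alpha>+Y*\<beta>)/N"
    have cN: "c*(\<alpha>\<^sup>2+\<beta>\<^sup>2) = X*\<alpha>+Y*\<beta>" using N by (simp add: c_def N')
    have "N*(X - c*\<alpha>) = 0" using or cN unfolding N' by algebra
    then have X: "X = c*\<alpha>" using N by simp
    have "N*(Y - c*\<beta>) = 0" using or cN unfolding N' by algebra
    then have Y: "Y = c*\<beta>" using N by simp
    have "c\<^sup>2*N = N" using nn unfolding X Y N' by algebra
    then have "c\<^sup>2 = 1" using N by simp
    then have "c = 1 \<or> c = -1" by (simp add: power2_eq_1_iff)
    have P1: "p*N = c*\<alpha>\<^sup>2 + \<beta>\<^sup>2" and P2: "r*N = (c-1)*\<alpha>*\<beta>"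
      using X D1 unfolding X_def N' by algebra+
    have P3: "s*N = (c-1)*\<alpha>*\<beta>" and P4: "w*N = c*\<beta>\<^sup>2+\<alpha>\<^sup>2"
      using Y D2 unfolding Y_def N' by algebra+
    note P = P1 P2 P3 P4
    have "c \<noteq> 1"
    proof
      assume c: "c = 1"
      have "p*N = N" "r*N = 0" "s*N = 0" "w*N = N"
        unfolding P c by (simp_all add: N')
      then have "p = 1" "r = 0" "s = 0" "w = 1" using N by simp_all
      then have "affine_map A t = id"
        using f0 by (auto simp: fun_eq_iff ap vec_eq_iff forall_2 d)
      then show False using f(2) by (simp add: is_symmetry_def)
    qed
    with \<open>c = 1 \<or> c = -1\<close> have c: "c = -1" by simp
    have "p*N = N - 2*\<alpha>*\<alpha>" "r*N = -2*\<alpha>*\<beta>" "s*N = -2*\<alpha>*\<beta>" "w*N = N - 2*\<beta>*\<beta>"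
      unfolding P c by (simp_all add: N' power2_eq_square)
    then have "p = (N - 2*\<alpha>*\<alpha>)/N" "r = -2*\<alpha>*\<beta>/N" "s = -2*\<alpha>*\<beta>/N" "w = (N - 2*\<beta>*\<beta>)/N"
      using N by (simp_all only: eq_divide_eq if_True if_False simp_thms)
    then have PP: "p = 1 - 2*\<alpha>*\<alpha>/N" "r = -2*\<alpha>*\<beta>/N" "s = -2*\<alpha>*\<beta>/N" "w = 1 - 2*\<beta>*\<beta>/N"
      using N by (simp_all only: diff_divide_distrib divide_self if_True if_False simp_thms)
    then have AA: "A = A0" by (simp add: A0_def vec_eq_iff forall_2 d)
    have "affine_map A0 t0 (vector [x0,y0]) = vector [x0,y0]"
      using ex inc[of x0 y0] o by (simp add: is_symmetry_def)
    moreover have "affine_map A t (vector [x0,y0]) = vector [x0,y0]"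
      using f(2) inc[of x0 y0] o by (simp add: is_symmetry_def)
    ultimately have "affine_map A0 t (vector [x0,y0]) = affine_map A0 t0 (vector [x0,y0])"
      by (simp only: AA)
    then have "t = t0" by (simp add: affine_map_def)
    then show ?thesis by (simp add: f AA)
  qed
  show ?thesis
  proof (rule ex1I[of _ "affine_map A0 t0"])
    show "\<exists>A t. affine_map A0 t0 = affine_map A t \<and> is_symmetry L A t"
      using ex by (intro exI conjI) (rule refl)
  next
    fix f assume "\<exists>A t. f = affine_map A t \<and> is_symmetry L A t"
    then show "f = affine_map A0 t0" by (elim exE conjE) (rule un)
  qed
qed

definition projective_extension :: "complex^2^2 \<Rightarrow> complex^2 \<Rightarrow> cp2 \<Rightarrow> cp2" where
  "projective_extension A t p = abs_cp2
     (vector [vector [A $ 1 $ 1, A $ 1 $ 2, t $ 1],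
              vector [A $ 2 $ 1, A $ 2 $ 2, t $ 2],
              vector [0, 0, 1]] *v rep_cp2 p)"

definition reflected :: "cline \<Rightarrow> cline \<Rightarrow> cline \<Rightarrow> bool" where
  "reflected L l l' \<longleftrightarrow>
     (\<exists>A t. is_symmetry L A t \<and> line_points l' = projective_extension A t ` line_points l)"

definition symmetric_lines :: "cline \<Rightarrow> cp2 \<Rightarrow> cline \<Rightarrow> cline \<Rightarrow> bool" where
  "symmetric_lines L p l l' \<longleftrightarrow>
     incident p L \<and> incident p l \<and> incident p l' \<and>
     (if \<not> isotropic L then reflected L l l'
      else L \<noteq> line_at_infinity \<and>
        (\<exists>ls ls' Ls ps.
           (\<forall>k::nat. incident (ps k) (ls k) \<and> incident (ps k) (ls' k) \<and> incident (ps k) (Ls k) \<and>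
              \<not> isotropic (Ls k) \<and> reflected (Ls k) (ls k) (ls' k)) \<and>
           (\<lambda>k. (ls k, ls' k, Ls k, ps k)) \<longlonglongrightarrow> (l, l', L, p)))"

text \<open>A conic is given by a symmetric invertible matrix, which it determines up to scaling; the
  notions below do not depend on the scaling. The tangent line at a point has the
  gradient of the quadratic form as its coefficient vector.\<close>

definition conic_points :: "complex^3^3 \<Rightarrow> cp2 set" where
  "conic_points M = {p. bil (rep_cp2 p) (M *v rep_cp2 p) = 0}"

definition tangent_line :: "complex^3^3 \<Rightarrow> cp2 \<Rightarrow> cline" where
  "tangent_line M p = abs_cp2 (M *v rep_cp2 p)"

definition tangent_to :: "complex^3^3 \<Rightarrow> cline \<Rightarrow> bool" where
  "tangent_to M l \<longleftrightarrow> (\<exists>p\<in>conic_points M. l = tangent_line M p)"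

definition general_position :: "complex^3^3 \<Rightarrow> complex^3^3 \<Rightarrow> bool" where
  "general_position M M' \<longleftrightarrow> card (conic_points M \<inter> conic_points M') = 4"

text \<open>A tuple with indices modulo \<open>n\<close> is an \<open>n\<close>-periodic family indexed by the integers;
  \<open>n\<close> need not be the least period.\<close>

definition nondegenerate_orbit :: "nat \<Rightarrow> complex^3^3 \<Rightarrow> (int \<Rightarrow> cp2) \<Rightarrow> bool" where
  "nondegenerate_orbit n M p \<longleftrightarrow>
     (\<forall>j. p (j + int n) = p j) \<and>
     (\<forall>j. p j \<in> conic_points M \<and> p j \<noteq> p (j + 1) \<and> \<not> isotropic (tangent_line M (p j)) \<and>
        symmetric_lines (tangent_line M (p j)) (p j)
          (line_through (p (j - 1)) (p j)) (line_through (p j) (p (j + 1))))"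

definition circumscribed :: "(int \<Rightarrow> cp2) \<Rightarrow> complex^3^3 \<Rightarrow> bool" where
  "circumscribed p M' \<longleftrightarrow>
     (\<forall>j. {l. tangent_to M' l \<and> incident (p j) l} =
        {line_through (p (j - 1)) (p j), line_through (p j) (p (j + 1))})"

definition complex_caustic :: "complex^3^3 \<Rightarrow> complex^3^3 \<Rightarrow> bool" where
  "complex_caustic M M' \<longleftrightarrow>
     (\<forall>l p. tangent_to M' l \<and> incident p l \<and> p \<in> conic_points M \<longrightarrow>
        (\<exists>l'. symmetric_lines (tangent_line M p) p l l' \<and> tangent_to M' l'))"

definition n_caustic :: "nat \<Rightarrow> complex^3^3 \<Rightarrow> complex^3^3 \<Rightarrow> bool" where
  "n_caustic n M M' \<longleftrightarrow>
     general_position M M' \<and> complex_caustic M M' \<and>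
     (\<exists>p. nondegenerate_orbit n M p \<and> circumscribed p M')"

definition confocal :: "real \<Rightarrow> real \<Rightarrow> complex \<Rightarrow> complex^3^3" where
  "confocal a b \<mu> = vector [vector [1 / (of_real a - \<mu>), 0, 0],
                            vector [0, 1 / (of_real b - \<mu>), 0],
                            vector [0, 0, -1]]"

lemma confocal_symmetric_invertible:
  assumes "\<mu> \<notin> {of_real a, of_real b}"
  shows "transpose (confocal a b \<mu>) = confocal a b \<mu>" "det (confocal a b \<mu>) \<noteq> 0"
  using assms by (auto simp: confocal_def transpose_def vec_eq_iff forall_3 det_3)

lemma affine_equation_confocal:
  "hcoord x y 1 \<in> conic_points (confocal a b \<mu>) \<longleftrightarrow>
     x\<^sup>2 / (of_real a - \<mu>) + y\<^sup>2 / (of_real b - \<mu>) = 1"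
proof -
  let ?v = "vector [x, y, 1] :: complex^3"
  have "?v \<noteq> 0" by (auto simp: vec_eq_iff forall_3)
  then have "proportional ?v ?v" by (auto simp: proportional_def intro: exI[of _ 1])
  then have "proportional ?v (rep_cp2 (hcoord x y 1))"
    unfolding hcoord_def by (metis Quotient_cp2 Quotient_rel_rep Quotient_rep_abs Quotient_rel Quotient_abs_rep Quotient_rep_reflp)
  then obtain c where c: "rep_cp2 (hcoord x y 1) = c *s ?v" "c \<noteq> 0"
    unfolding proportional_def by auto
  have "bil (c *s ?v) (confocal a b \<mu> *v (c *s ?v)) =
      c\<^sup>2 * (x\<^sup>2 / (of_real a - \<mu>) + y\<^sup>2 / (of_real b - \<mu>) - 1)"
    by (simp add: bil_def sum_3 matrix_vector_mult_def confocal_def power2_eq_square algebra_simps)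
  with c show ?thesis by (simp add: conic_points_def)
qed

text \<open>Conics are counted as subsets of the plane, so that the scaling of the matrix is irrelevant.\<close>

definition num_caustics :: "real \<Rightarrow> real \<Rightarrow> nat \<Rightarrow> nat" where
  "num_caustics a b n =
     card {conic_points (confocal a b \<mu>) | \<mu>.
             \<mu> \<notin> {of_real a, of_real b} \<and> n_caustic n (confocal a b 0) (confocal a b \<mu>)}"

end

theory Submission
  imports Defs "Jordan_Normal_Form.Determinant" "HOL-Computational_Algebra.Polynomial_FPS"
    "HOL-Computational_Algebra.Fundamental_Theorem_Algebra"
begin

text \<open>A billiard orbit of \<open>C\<close> circumscribed about \<open>C_\<mu>\<close> is a Poncelet polygon, and Cayley's
criterion says when such polygons close after \<open>n\<close> steps: with
\<open>D(z) = (1 + (1 - \<mu>/a) z) (1 + (1 - \<mu>/b) z) (1 + z)\<close>, which is the determinant of the conic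
\<open>C_\<mu> + z C\<close> up to a constant, a Toeplitz determinant in the Taylor coefficients of
\<open>\<surd>D(z)\<close> has to vanish. The coefficient of \<open>z\<^sup>k\<close> is a polynomial of degree at most \<open>k\<close> in \<open>\<mu>\<close>,
so the determinant, as a polynomial in \<open>\<mu>\<close> (\<open>cayley_poly\<close>), has degree at most
\<open>(n\<^sup>2 - 1)/4\<close> or \<open>n\<^sup>2/4 - 1\<close> according to the parity of \<open>n\<close>. It vanishes at every \<open>\<mu>\<close> whose conic
is an \<open>n\<close>-caustic (\<open>n_caustic_imp_cayley\<close>) and not at \<open>\<mu> = 0\<close> (\<open>cayley_poly_0\<close>); hence the set of these
\<open>\<mu>\<close> is finite and obeys the degree bound, and the product of the \<open>X - \<mu>\<close> over it is the polynomial
required. Part (3) holds because different \<open>\<mu>\<close> give different conics.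

Vanishing on caustics. Choose a common point \<open>b\<close> of \<open>C\<close> and \<open>C_\<mu>\<close> that is not a vertex of the given
polygon. A vertex \<open>p_j\<close> is recorded by the number \<open>z_j\<close> such that the line \<open>b p_j\<close> is tangent to
\<open>C_\<mu> + z_j C\<close> at \<open>b\<close>; this is a rational parametrisation of \<open>C\<close>. The side \<open>p_j p_{j+1}\<close> touches
\<open>C_\<mu>\<close> exactly if \<open>(0, 1)\<close> is collinear with points of the cubic curve \<open>y\<^sup>2 = D(z)\<close> above \<open>z_j\<close> and
\<open>z_{j+1}\<close>, and the two sides at a vertex correspond to the two choices of the sign of \<open>y\<close>. So the
polygon becomes a sequence of points \<open>u_{j+1} = u_j + \<tau>\<close> on the cubic, with \<open>\<tau> = (0, 1)\<close>, and
closing up means \<open>n\<tau> = 0\<close>. This is made explicit by the product of the functions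
\<open>(y - l_j(z)) / (z - z_j)\<close>, where \<open>l_j\<close> is the secant through \<open>\<tau>\<close> and \<open>u_j\<close>: the product telescopes to
\<open>P(z) + Q(z) y\<close> with divisor \<open>n\<tau> - n\<infinity>\<close>, hence with norm \<open>P\<^sup>2 - Q\<^sup>2 D = k z\<^sup>n\<close>
(\<open>closed_chain_imp_pell\<close>). Then \<open>P + Q \<surd>D\<close> vanishes to order \<open>n\<close> at \<open>z = 0\<close>, and the coefficients of
\<open>Q\<close> are a linear relation between the columns of the Toeplitz matrix
(\<open>pell_imp_toeplitz_singular\<close>).

Not vanishing at \<open>\<mu> = 0\<close>. There \<open>D = (1 + z)\<^sup>3\<close>, the curve is rational with parameter \<open>w\<close>,
\<open>z = w\<^sup>2 - 1\<close>, and \<open>P + Q \<surd>D\<close> is a polynomial in \<open>w\<close> without linear term. Its norm forces it to be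
a multiple of \<open>(w - 1)\<^sup>i (w + 1)\<^sup>j\<close>, and the linear term of this vanishes only for \<open>i = j\<close>, when \<open>Q = 0\<close>
(\<open>pell_cube_trivial\<close>).\<close>

no_notation vec_index (infixl "$" 100)

section \<open>Singular Toeplitz matrices and the Pell equation\<close>

definition toeplitz :: "(nat \<Rightarrow> 'a) \<Rightarrow> nat \<Rightarrow> nat \<Rightarrow> 'a mat" where
  "toeplitz w p s = mat s s (\<lambda>(i, k). w (Suc p + i - k))"

lemma fps_nth_poly_mult:
  fixes Q :: "complex poly" and w :: "nat \<Rightarrow> complex"
  assumes "\<And>k. k \<ge> s \<Longrightarrow> coeff Q k = 0" and "s \<le> Suc r"
  shows "fps_nth (fps_of_poly Q * Abs_fps w) r = (\<Sum>k<s. coeff Q k * w (r - k))"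
  unfolding fps_mult_nth using assms by (intro sum.mono_neutral_cong_right) auto

text \<open>A kernel vector is the list of coefficients of \<open>Q\<close>, because multiplying by the matrix computes the
coefficients number \<open>p + 1, \<dots>, p + s\<close> of \<open>Q\<close> times the series of \<open>w\<close>.\<close>

lemma det_toeplitz_eq_0_iff:
  fixes w :: "nat \<Rightarrow> complex"
  assumes "s \<le> Suc p"
  shows "det (toeplitz w p s) = 0 \<longleftrightarrow>
    (\<exists>Q. Q \<noteq> 0 \<and> degree Q < s \<and>
      (\<forall>i<s. fps_nth (fps_of_poly Q * Abs_fps w) (Suc p + i) = 0))"
    (is "_ \<longleftrightarrow> (\<exists>Q. ?R Q)")
proof -
  have carr: "toeplitz w p s \<in> carrier_mat s s" by (simp add: toeplitz_def)
  have prod: "vec_index (toeplitz w p s *\<^sub>v v) i = fps_nth (fps_of_poly Q * Abs_fps w) (Suc p + i)"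
    if "i < s" "dim_vec v = s" "\<And>k. coeff Q k = (if k < s then vec_index v k else 0)" for v Q i
  proof -
    have "vec_index (toeplitz w p s *\<^sub>v v) i = (\<Sum>k<s. w (Suc p + i - k) * vec_index v k)"
      using that(1,2) by (simp add: toeplitz_def scalar_prod_def atLeast0LessThan)
    also have "\<dots> = fps_nth (fps_of_poly Q * Abs_fps w) (Suc p + i)"
      using assms that(3) by (subst fps_nth_poly_mult[of s]) (auto simp: mult.commute intro!: sum.cong)
    finally show ?thesis .
  qed
  show ?thesis unfolding det_0_iff_vec_prod_zero_field[OF carr]
  proof
    assume "\<exists>v. v \<in> carrier_vec s \<and> v \<noteq> 0\<^sub>v s \<and> toeplitz w p s *\<^sub>v v = 0\<^sub>v s"
    then obtain v where v: "dim_vec v = s" "v \<noteq> 0\<^sub>v s" "toeplitz w p s *\<^sub>v v = 0\<^sub>v s"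
      by (blast dest: carrier_vecD)
    define Q where "Q = (\<Sum>k<s. monom (vec_index v k) k)"
    have Q: "coeff Q k = (if k < s then vec_index v k else 0)" for k
      by (simp add: Q_def coeff_sum)
    have "\<exists>k<s. vec_index v k \<noteq> 0"
    proof (rule ccontr)
      assume "\<not> (\<exists>k<s. vec_index v k \<noteq> 0)"
      then have "v = 0\<^sub>v s" using v(1) by (intro eq_vecI) auto
      with v(2) show False ..
    qed
    then obtain k where "k < s" "vec_index v k \<noteq> 0" by blast
    then have "coeff Q k \<noteq> 0" using Q[of k] by simp
    then have "Q \<noteq> 0" by (metis coeff_0)
    moreover have "coeff Q (degree Q) \<noteq> 0" using \<open>Q \<noteq> 0\<close> by simp
    then have "degree Q < s" using Q[of "degree Q"] by presburger
    moreover have "fps_nth (fps_of_poly Q * Abs_fps w) (Suc p + i) = 0" if "i < s" for i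
      using prod[OF that v(1) Q] v(3) that by simp
    ultimately show "\<exists>Q. ?R Q" by blast
  next
    assume "\<exists>Q. ?R Q"
    then obtain Q where Q: "Q \<noteq> 0" "degree Q < s"
      and z: "\<And>i. i < s \<Longrightarrow> fps_nth (fps_of_poly Q * Abs_fps w) (Suc p + i) = 0" by blast
    define v where "v = vec s (coeff Q)"
    have v: "dim_vec v = s" by (simp add: v_def)
    have cQ: "coeff Q k = (if k < s then vec_index v k else 0)" for k
      using Q(2) by (auto simp: v_def coeff_eq_0)
    have "vec_index v (degree Q) \<noteq> 0" using Q by (simp add: v_def)
    then have "v \<noteq> 0\<^sub>v s" using Q(2) by auto
    moreover have "toeplitz w p s *\<^sub>v v = 0\<^sub>v s"
    proof (rule eq_vecI)
      fix i assume "i < dim_vec (0\<^sub>v s :: complex vec)"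
      then show "vec_index (toeplitz w p s *\<^sub>v v) i = vec_index (0\<^sub>v s) i"
        using prod[of i v Q] v cQ z by simp
    qed (simp add: toeplitz_def)
    ultimately show "\<exists>v. v \<in> carrier_vec s \<and> v \<noteq> 0\<^sub>v s \<and> toeplitz w p s *\<^sub>v v = 0\<^sub>v s"
      using v by (auto intro!: exI[of _ v])
  qed
qed

text \<open>In each term of the Leibniz expansion the indices \<open>p + 1 + i - \<pi>(i)\<close> add up to \<open>s (p + 1)\<close>.\<close>

lemma degree_det_toeplitz:
  fixes c :: "nat \<Rightarrow> complex poly"
  assumes "\<And>k. degree (c k) \<le> k" and "s \<le> Suc p"
  shows "degree (det (toeplitz c p s)) \<le> s * Suc p"
proof -
  have "degree (signof \<pi> * (\<Prod>i = 0..<s. toeplitz c p s $$ (i, \<pi> i))) \<le> s * Suc p"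
    if \<pi>: "\<pi> permutes {0..<s}" for \<pi>
  proof -
    have lt: "\<pi> i < s" if "i < s" for i using permutes_in_image[OF \<pi>, of i] that by simp
    have "degree (\<Prod>i = 0..<s. toeplitz c p s $$ (i, \<pi> i)) \<le> (\<Sum>i = 0..<s. Suc p + i - \<pi> i)"
    proof (rule order.trans[OF degree_prod_sum_le])
      show "sum (degree \<circ> (\<lambda>i. toeplitz c p s $$ (i, \<pi> i))) {0..<s} \<le> (\<Sum>i = 0..<s. Suc p + i - \<pi> i)"
        using lt assms(1) by (intro sum_mono) (simp add: toeplitz_def)
    qed simp
    also have "\<dots> = s * Suc p"
    proof -
      have "(\<Sum>i = 0..<s. Suc p + i - \<pi> i) + (\<Sum>i = 0..<s. \<pi> i) = (\<Sum>i = 0..<s. Suc p + i)"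
        unfolding sum.distrib[symmetric]
      proof (rule sum.cong)
        fix i assume "i \<in> {0..<s}"
        then show "Suc p + i - \<pi> i + \<pi> i = Suc p + i" using lt[of i] assms(2) by simp
      qed simp
      also have "\<dots> = s * Suc p + (\<Sum>i = 0..<s. i)"
        by (simp only: sum.distrib) simp
      also have "(\<Sum>i = 0..<s. i) = (\<Sum>i = 0..<s. \<pi> i)" using sum.permute[OF \<pi>, of id] by simp
      finally show ?thesis by simp
    qed
    finally have "degree (\<Prod>i = 0..<s. toeplitz c p s $$ (i, \<pi> i)) \<le> s * Suc p" .
    then show ?thesis by (cases "evenperm \<pi>") (simp_all add: sign_def)
  qed
  then show ?thesis
    by (subst det_def'[of _ s]) (auto simp: toeplitz_def intro!: degree_sum_le finite_permutations)
qed

lemma poly_det_toeplitz: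
  "poly (det (toeplitz c p s)) x = det (toeplitz (\<lambda>k. poly (c k) x) p s)"
  for c :: "nat \<Rightarrow> complex poly"
proof -
  interpret comm_ring_hom "\<lambda>q :: complex poly. poly q x" by unfold_locales auto
  have "toeplitz (\<lambda>k. poly (c k) x) p s = map_mat (\<lambda>q. poly q x) (toeplitz c p s)"
    by (auto simp: toeplitz_def)
  then show ?thesis by simp
qed

text \<open>Solving \<open>W\<^sup>2 = \<Sum> d_k z\<^sup>k\<close>, \<open>d_0 = 1\<close>, for the coefficients of \<open>W\<close> one after the other keeps them
polynomial in the parameter on which \<open>d\<close> depends, and shows their degrees.\<close>

fun root_coeff :: "(nat \<Rightarrow> complex poly) \<Rightarrow> nat \<Rightarrow> complex poly" where
  "root_coeff d 0 = 1"
| "root_coeff d (Suc k) =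
     [:1/2:] * (d (Suc k) - (\<Sum>i<k. root_coeff d (Suc i) * root_coeff d (k - i)))"

declare root_coeff.simps(2) [simp del]

lemma degree_root_coeff:
  assumes "\<And>k. degree (d k) \<le> k"
  shows "degree (root_coeff d k) \<le> k"
proof (induction k rule: less_induct)
  case (less k)
  show ?case
  proof (cases k)
    case (Suc j)
    have "degree (root_coeff d (Suc i) * root_coeff d (j - i)) \<le> Suc j" if "i < j" for i
    proof -
      have "degree (root_coeff d (Suc i)) + degree (root_coeff d (j - i)) \<le> Suc i + (j - i)"
        using that Suc by (intro add_mono less.IH) auto
      then show ?thesis using that by (intro order.trans[OF degree_mult_le]) simp
    qed
    then have "degree (d (Suc j) - (\<Sum>i<j. root_coeff d (Suc i) * root_coeff d (j - i))) \<le> Suc j"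
      using assms by (intro degree_diff_le degree_sum_le) auto
    then show ?thesis unfolding Suc by (subst root_coeff.simps(2), intro order.trans[OF degree_mult_le]) simp
  qed simp
qed

lemma root_coeff_square:
  assumes "d 0 = 1"
  shows "(\<Sum>i\<le>k. root_coeff d i * root_coeff d (k - i)) = d k"
proof (cases k)
  case 0 then show ?thesis using assms by simp
next
  case (Suc j)
  have "(\<Sum>i\<le>Suc j. root_coeff d i * root_coeff d (Suc j - i))
      = root_coeff d (Suc j) + (\<Sum>i\<le>j. root_coeff d (Suc i) * root_coeff d (j - i))"
    by (subst sum.atMost_Suc_shift) simp
  also have "(\<Sum>i\<le>j. root_coeff d (Suc i) * root_coeff d (j - i))
      = (\<Sum>i<j. root_coeff d (Suc i) * root_coeff d (j - i)) + root_coeff d (Suc j)"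
    by (simp add: lessThan_Suc_atMost[symmetric])
  also have "root_coeff d (Suc j) +
      ((\<Sum>i<j. root_coeff d (Suc i) * root_coeff d (j - i)) + root_coeff d (Suc j)) = d (Suc j)"
  proof -
    have "root_coeff d (Suc j) + root_coeff d (Suc j) =
        d (Suc j) - (\<Sum>i<j. root_coeff d (Suc i) * root_coeff d (j - i))"
      by (subst (1 2) root_coeff.simps(2)) (simp flip: smult_add_left)
    moreover have "r + (x + r) = (r + r) + x" for r x :: "complex poly" by simp
    ultimately show ?thesis by simp
  qed
  finally show ?thesis unfolding Suc .
qed

text \<open>Put \<open>z = w\<^sup>2 - 1\<close> and \<open>R(w) = P(w\<^sup>2 - 1) + w\<^sup>3 Q(w\<^sup>2 - 1)\<close>. The equation reads
\<open>R(w) R(-w) = c (w\<^sup>2 - 1)\<^sup>n\<close>, so for \<open>c \<noteq> 0\<close> all roots of \<open>R\<close> are \<open>\<plusminus>1\<close>. Since \<open>R\<close> has no linear term,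
both have the same multiplicity; then \<open>R\<close> is even, and its odd part \<open>w\<^sup>3 Q(w\<^sup>2 - 1)\<close> is zero.
For \<open>c = 0\<close> the degrees of \<open>P\<^sup>2\<close> and \<open>Q\<^sup>2 (1 + z)\<^sup>3\<close> have different parity.\<close>

lemma pell_cube_trivial:
  fixes P Q :: "complex poly"
  assumes pell: "P\<^sup>2 - Q\<^sup>2 * [:1, 1:] ^ 3 = monom c n"
  shows "Q = 0"
proof (cases "c = 0")
  case True
  then have eq: "P\<^sup>2 = Q\<^sup>2 * [:1, 1:] ^ 3" using pell by simp
  show ?thesis
  proof (rule ccontr)
    assume "Q \<noteq> 0"
    then have "degree (Q\<^sup>2 * [:1, 1:] ^ 3) = 2 * degree Q + 3"
      by (simp add: degree_mult_eq degree_power_eq)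
    then have "2 * degree P = 2 * degree Q + 3"
      unfolding eq[symmetric] by (cases "P = 0") (auto simp: degree_power_eq)
    then show False by presburger
  qed
next
  case False
  define s :: "complex poly" where "s = [:-1, 0, 1:]"
  define Z :: "complex poly" where "Z = [:0, 1:]"
  define E O' where "E = pcompose P s" and "O' = Z ^ 3 * pcompose Q s"
  define R where "R = E + O'"
  have pE: "poly E (- w) = poly E w" and pO: "poly O' (- w) = - poly O' w" for w
    by (simp_all add: E_def O'_def poly_pcompose s_def Z_def power2_eq_square)
  have prod: "poly R w * poly R (- w) = c * (w\<^sup>2 - 1) ^ n" for w
  proof -
    have "poly R w * poly R (- w) = (poly E w)\<^sup>2 - (poly O' w)\<^sup>2"
      by (simp add: R_def pE pO power2_eq_square algebra_simps)
    also have "\<dots> = poly (P\<^sup>2 - Q\<^sup>2 * [:1, 1:] ^ 3) (w\<^sup>2 - 1)"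
      by (simp add: E_def O'_def poly_pcompose s_def Z_def power2_eq_square algebra_simps
          eval_nat_numeral)
    finally show ?thesis unfolding pell by (simp add: poly_monom)
  qed
  have R0: "poly R 0 \<noteq> 0" using prod[of 0] False by auto
  then have "R \<noteq> 0" by auto
  have roots: "{w. poly R w = 0} \<subseteq> {1, -1}"
  proof
    fix w assume "w \<in> {w. poly R w = 0}"
    then have "c * (w\<^sup>2 - 1) ^ n = 0" using prod[of w] by simp
    then have "w\<^sup>2 = 1" using False by auto
    then show "w \<in> {1, -1}" by (simp add: power2_eq_1_iff)
  qed
  define i j where "i = order 1 R" and "j = order (-1) R"
  have "R = Polynomial.smult (lead_coeff R) (\<Prod>w | poly R w = 0. [:-w, 1:] ^ order w R)"
    by (simp add: complex_poly_decompose)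
  also have "(\<Prod>w | poly R w = 0. [:-w, 1:] ^ order w R) = (\<Prod>w\<in>{1, -1}. [:-w, 1:] ^ order w R)"
    using roots \<open>R \<noteq> 0\<close> by (intro prod.mono_neutral_left) (auto simp: order_root)
  also have "\<dots> = [:-1, 1:] ^ i * [:1, 1:] ^ j" by (simp add: i_def j_def)
  finally have dec: "R = Polynomial.smult (lead_coeff R) ([:-1, 1:] ^ i * [:1, 1:] ^ j)" .
  have "poly (pderiv R) 0 = 0"
  proof -
    have "pderiv R = pderiv (pcompose P s) + pderiv (Z ^ 3 * pcompose Q s)"
      by (simp add: R_def E_def O'_def pderiv_add)
    then show ?thesis by (simp add: pderiv_pcompose pderiv_mult s_def Z_def pderiv_pCons eval_nat_numeral)
  qed
  moreover have "poly (pderiv R) 0 = lead_coeff R * ((-1) ^ i * (of_nat j - of_nat i))"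
  proof -
    have d: "poly (pderiv ([:t, 1:] ^ k)) 0 = of_nat k * t ^ (k - 1)" for t :: complex and k
      by (simp add: pderiv_power pderiv_pCons)
    have "poly (pderiv R) 0 = lead_coeff R * ((-1) ^ i * of_nat j + of_nat i * (-1) ^ (i - 1))"
      by (subst dec, simp only: pderiv_smult pderiv_mult poly_smult poly_add poly_mult poly_power d)
        simp
    also have "of_nat i * (-1) ^ (i - 1) = - ((-1) ^ i * of_nat i :: complex)" by (cases i) simp_all
    finally show ?thesis by (simp add: algebra_simps)
  qed
  ultimately have "i = j" using \<open>R \<noteq> 0\<close> by simp
  then have "poly R w = poly R (- w)" for w
    by (subst (1 2) dec) (simp add: power_mult_distrib[symmetric] algebra_simps)
  then have "poly O' w = 0" for w
    by (simp add: R_def pE pO eq_neg_iff_add_eq_0 flip: mult_2)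
  then have "O' = 0" using poly_all_0_iff_0 by blast
  then have "pcompose Q s = 0" by (simp add: O'_def Z_def)
  then show "Q = 0" by (subst (asm) pcompose_eq_0_iff) (auto simp: s_def)
qed

text \<open>The two terms on the left have degrees of different parity, so their leading terms do not cancel.\<close>

lemma degree_pell_solution:
  fixes P Q D :: "complex poly"
  assumes pell: "P\<^sup>2 - Q\<^sup>2 * D = monom c n" and c: "c \<noteq> 0" and D: "degree D = 3" and Q: "Q \<noteq> 0"
  shows "2 * degree P \<le> n" and "2 * degree Q + 3 \<le> n"
proof -
  have dQ: "degree (Q\<^sup>2 * D) = 2 * degree Q + 3"
    using D Q by (subst degree_mult_eq) (auto simp: degree_power_eq)
  have dP: "degree (P\<^sup>2) = 2 * degree P" by (cases "P = 0") (simp_all add: degree_power_eq)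
  have n: "degree (P\<^sup>2 - Q\<^sup>2 * D) = n" unfolding pell using c by (simp add: degree_monom_eq)
  have ne: "2 * degree P \<noteq> 2 * degree Q + 3" by presburger
  then have "max (2 * degree P) (2 * degree Q + 3) = n"
  proof (cases "2 * degree P < 2 * degree Q + 3")
    case True
    then have "degree (P\<^sup>2 - Q\<^sup>2 * D) = 2 * degree Q + 3"
      using dP dQ degree_add_eq_right[of "P\<^sup>2" "- (Q\<^sup>2 * D)"] by simp
    with n True show ?thesis by simp
  next
    case False
    then have "degree (P\<^sup>2 - Q\<^sup>2 * D) = 2 * degree P"
      using dP dQ ne degree_add_eq_left[of "- (Q\<^sup>2 * D)" "P\<^sup>2"] by simp
    with n False show ?thesis by simp
  qed
  then show "2 * degree P \<le> n" "2 * degree Q + 3 \<le> n" by auto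
qed

text \<open>In \<open>(P + Q W) (P - Q W) = c z\<^sup>n\<close> the second factor is a unit because \<open>P(0) \<noteq> Q(0)\<close>, so the first is
divisible by \<open>z\<^sup>n\<close>. As \<open>deg P \<le> n/2\<close>, the coefficients of \<open>Q W\<close> between \<open>n/2\<close> and \<open>n\<close> vanish.\<close>

theorem pell_imp_toeplitz_singular:
  fixes P Q D :: "complex poly" and w :: "nat \<Rightarrow> complex"
  assumes pell: "P\<^sup>2 - Q\<^sup>2 * D = monom c n" and c: "c \<noteq> 0" and D: "degree D = 3"
    and ne: "poly P 0 \<noteq> poly Q 0" and n: "n \<noteq> 0"
    and w0: "w 0 = 1" and w2: "(Abs_fps w)\<^sup>2 = fps_of_poly D"
  shows "det (toeplitz w (n div 2) ((n - 1) div 2)) = 0"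
proof -
  let ?W = "Abs_fps w"
  have Q: "Q \<noteq> 0"
  proof
    assume "Q = 0"
    then have "(poly P 0)\<^sup>2 = poly (monom c n) 0" using pell by (metis diff_zero mult_zero_left poly_power zero_power2)
    then show False using n ne \<open>Q = 0\<close> by (simp add: poly_monom power_0_left)
  qed
  note deg = degree_pell_solution[OF pell c D Q]
  define U V where "U = fps_of_poly P + fps_of_poly Q * ?W" and "V = fps_of_poly P - fps_of_poly Q * ?W"
  have "U * V = fps_of_poly P ^ 2 - fps_of_poly Q ^ 2 * ?W\<^sup>2"
    by (simp add: U_def V_def power2_eq_square algebra_simps)
  also have "\<dots> = fps_of_poly (monom c n)"
    unfolding w2 pell[symmetric] by (simp add: fps_of_poly_diff fps_of_poly_mult fps_of_poly_power)
  also have "\<dots> = fps_const c * fps_X ^ n" by (simp add: fps_of_poly_monom)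
  finally have UV: "U * V = fps_const c * fps_X ^ n" .
  have V0: "fps_nth V 0 \<noteq> 0" using ne w0 by (simp add: V_def poly_0_coeff_0)
  have "U = U * V * inverse V" using V0 by (simp add: mult.assoc inverse_mult_eq_1')
  also have "\<dots> = fps_X ^ n * (fps_const c * inverse V)" unfolding UV by (simp add: mult_ac)
  finally have U: "fps_nth U r = 0" if "r < n" for r
    using that by (metis fps_X_power_mult_nth)
  have "fps_nth (fps_of_poly Q * ?W) (Suc (n div 2) + i) = 0" if "i < (n - 1) div 2" for i
  proof -
    have "fps_nth U (Suc (n div 2) + i) = 0" using that by (intro U) linarith
    moreover have "coeff P (Suc (n div 2) + i) = 0" using deg(1) by (intro coeff_eq_0) linarith
    ultimately show ?thesis by (simp add: U_def)
  qed
  moreover have "degree Q < (n - 1) div 2" using deg(2) by linarith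
  ultimately show ?thesis using Q by (subst det_toeplitz_eq_0_iff) auto
qed

text \<open>A kernel vector gives \<open>Q\<close> and, by truncating \<open>- Q W\<close>, a polynomial \<open>P\<close> with \<open>P + Q W = O(z\<^sup>n)\<close>. The
norm \<open>P\<^sup>2 - Q\<^sup>2 (1 + z)\<^sup>3\<close> has degree at most \<open>n\<close> and is divisible by \<open>z\<^sup>n\<close>: a Pell equation.\<close>

theorem toeplitz_cube_regular:
  fixes w :: "nat \<Rightarrow> complex"
  assumes n: "n \<noteq> 0" and w2: "(Abs_fps w)\<^sup>2 = fps_of_poly ([:1, 1:] ^ 3)"
  shows "det (toeplitz w (n div 2) ((n - 1) div 2)) \<noteq> 0"
proof
  let ?W = "Abs_fps w" and ?p = "n div 2" and ?s = "(n - 1) div 2"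
  assume det0: "det (toeplitz w ?p ?s) = 0"
  have "?s \<le> Suc ?p" by linarith
  from iffD1[OF det_toeplitz_eq_0_iff[OF this] det0] obtain Q where Q: "Q \<noteq> 0" "degree Q < ?s"
    and z: "\<And>i. i < ?s \<Longrightarrow> fps_nth (fps_of_poly Q * ?W) (Suc ?p + i) = 0"
    by blast
  define P where "P = - (\<Sum>k\<le>?p. monom (fps_nth (fps_of_poly Q * ?W) k) k)"
  have cP: "coeff P k = (if k \<le> ?p then - fps_nth (fps_of_poly Q * ?W) k else 0)" for k
    by (simp add: P_def coeff_sum)
  have "degree P \<le> ?p" by (rule degree_le) (simp add: cP)
  define U V where "U = fps_of_poly P + fps_of_poly Q * ?W" and "V = fps_of_poly P - fps_of_poly Q * ?W"
  have U: "fps_nth U r = 0" if "r < n" for r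
  proof (cases "r \<le> ?p")
    case True then show ?thesis by (simp add: U_def cP)
  next
    case False
    then have "r = Suc ?p + (r - Suc ?p)" "r - Suc ?p < ?s" using that by linarith+
    then have "fps_nth (fps_of_poly Q * ?W) r = 0" using z[of "r - Suc ?p"] by simp
    then show ?thesis using False by (simp add: U_def cP)
  qed
  have "U * V = fps_of_poly P ^ 2 - fps_of_poly Q ^ 2 * ?W\<^sup>2"
    by (simp add: U_def V_def power2_eq_square algebra_simps)
  also have "\<dots> = fps_of_poly (P\<^sup>2 - Q\<^sup>2 * [:1, 1:] ^ 3)"
    unfolding w2 by (simp add: fps_of_poly_diff fps_of_poly_mult fps_of_poly_power)
  finally have UV: "fps_of_poly (P\<^sup>2 - Q\<^sup>2 * [:1, 1:] ^ 3) = U * V" ..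
  define d where "d = P\<^sup>2 - Q\<^sup>2 * [:1, 1:] ^ 3"
  have low: "coeff d r = 0" if "r < n" for r
  proof -
    have "coeff d r = fps_nth (U * V) r" unfolding UV[symmetric] d_def by simp
    also have "\<dots> = 0" using U that by (simp add: fps_mult_nth)
    finally show ?thesis .
  qed
  have "degree d \<le> n"
    unfolding d_def
  proof (rule degree_diff_le)
    show "degree (P\<^sup>2) \<le> n"
      using \<open>degree P \<le> ?p\<close> degree_power_le[of P 2] by linarith
    have "degree (Q\<^sup>2 * [:1, 1:] ^ 3) = 2 * degree Q + 3"
      using Q(1) by (simp add: degree_mult_eq degree_power_eq)
    then show "degree (Q\<^sup>2 * [:1, 1:] ^ 3) \<le> n" using Q(2) by linarith
  qed
  have "d = monom (coeff d n) n"
  proof (rule poly_eqI)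
    fix r
    show "coeff d r = coeff (monom (coeff d n) n) r"
    proof (cases r n rule: linorder_cases)
      case less
      then show ?thesis using low[of r] by simp
    next
      case greater
      then have "coeff d r = 0" using \<open>degree d \<le> n\<close> by (intro coeff_eq_0) linarith
      with greater show ?thesis by simp
    qed simp
  qed
  then have "Q = 0" unfolding d_def by (rule pell_cube_trivial)
  with Q(1) show False ..
qed

section \<open>From a closed chain of secants to the Pell equation\<close>

text \<open>The line \<open>y = 1 + m z\<close> meets the cubic \<open>y\<^sup>2 = 1 + d1 z + d2 z\<^sup>2 + d3 z\<^sup>3\<close> above \<open>0\<close>, \<open>u\<close> and \<open>v\<close>.\<close>

lemma secant_line_divisor:
  fixes d1 d2 d3 m u v :: complex
  assumes "2 * m = d1 - d3 * u * v" and "m\<^sup>2 = d2 + d3 * (u + v)"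
  shows "[:1, m:]\<^sup>2 - [:1, d1, d2, d3:] = - ([:d3:] * ([:0, 1:] * [:-u, 1:] * [:-v, 1:]))"
proof -
  have "d1 = 2 * m + d3 * u * v" using assms(1) by simp
  moreover have "d2 = m * m - d3 * (u + v)" using assms(2) by (simp add: power2_eq_square)
  ultimately show ?thesis by (simp add: power2_eq_square algebra_simps)
qed

text \<open>One step of the telescoping product. The function \<open>P + Q y\<close> vanishes at \<open>(u, -e)\<close>, the line
\<open>y - l\<close> at \<open>(u, e)\<close> and \<open>(v, -e')\<close>. Their product \<open>(Q D - P l) + (P - Q l) y\<close> vanishes at both points
above \<open>u\<close>, so it is divisible by \<open>z - u\<close>, and the quotient \<open>P' + Q' y\<close> vanishes at \<open>(v, -e')\<close>.\<close>

lemma secant_step: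
  fixes P Q D l :: "complex poly" and u v e e' :: complex
  assumes P: "poly P u = poly Q u * e" and lu: "poly l u = e" and lv: "poly l v = - e'"
    and Du: "poly D u = e\<^sup>2" and Dv: "poly D v = e'\<^sup>2" and uv: "u \<noteq> v"
  obtains P' Q' where "[:-u, 1:] * P' = Q * D - P * l" and "[:-u, 1:] * Q' = P - Q * l"
    and "poly P' v = poly Q' v * e'"
proof -
  have "poly (Q * D - P * l) u = 0" "poly (P - Q * l) u = 0"
    using P lu Du by (simp_all add: power2_eq_square)
  then obtain P' Q' where P': "Q * D - P * l = [:-u, 1:] * P'" and Q': "P - Q * l = [:-u, 1:] * Q'"
    by (metis poly_eq_0_iff_dvd dvdE)
  have "(v - u) * poly P' v = poly ([:-u, 1:] * P') v" by (simp add: algebra_simps)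
  also have "\<dots> = e' * (poly P v + poly Q v * e')"
    unfolding P'[symmetric] using lv Dv by (simp add: power2_eq_square algebra_simps)
  also have "\<dots> = e' * poly ([:-u, 1:] * Q') v" unfolding Q'[symmetric] using lv by simp
  also have "\<dots> = (v - u) * (poly Q' v * e')" by (simp add: algebra_simps)
  finally have "(v - u) * poly P' v = (v - u) * (poly Q' v * e')" .
  then have "poly P' v = poly Q' v * e'" using uv by simp
  with P' Q' that show ?thesis by metis
qed

text \<open>The points \<open>u_j = (x_j, e_j)\<close> with \<open>e_j = 1 + m_j x_j\<close> satisfy \<open>u_{j+1} = u_j + (0, 1)\<close> on the cubic:
the line of slope \<open>m_j\<close> through \<open>(0, 1)\<close> and \<open>u_j\<close> meets it again above \<open>x_{j+1}\<close>, by \<open>sec1\<close> and \<open>sec2\<close>,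
at the height \<open>- e_{j+1}\<close>, by \<open>turn\<close>. Let \<open>G_k\<close> be the product of the functions
\<open>(y - l_j) / (z - x_j)\<close> for \<open>j < k\<close>. The induction follows the two multiples \<open>P + Q y = (z - x_0) G_k\<close>
and \<open>S + T y = (y + e_0) G_k\<close>, which are polynomial and vanish at \<open>- u_k\<close>. When \<open>u_n = u_0\<close>, this
pair shows that multiplication by \<open>G_n\<close> preserves the ideal of \<open>- u_0\<close>, generated by \<open>z - x_0\<close> and
\<open>y + e_0\<close>; as the curve is smooth there, \<open>G_n\<close> itself is polynomial.\<close>

theorem closed_chain_imp_pell:
  fixes d1 d2 d3 :: complex and x m :: "nat \<Rightarrow> complex" and n :: nat
  defines "D \<equiv> [:1, d1, d2, d3:]"
  assumes sec1: "\<And>j. 2 * m j = d1 - d3 * x j * x (Suc j)"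
    and sec2: "\<And>j. (m j)\<^sup>2 = d2 + d3 * (x j + x (Suc j))"
    and turn: "\<And>j. (m j + m (Suc j)) * x (Suc j) = - 2"
    and step: "\<And>j. x j \<noteq> x (Suc j)" and nz: "\<And>j. x j \<noteq> 0"
    and closed: "x n = x 0" "m n = m 0"
    and d3: "d3 \<noteq> 0" and simple: "rsquarefree D"
  obtains P Q c where "c \<noteq> 0" "P\<^sup>2 - Q\<^sup>2 * D = monom c n" "poly P 0 \<noteq> poly Q 0"
proof -
  define e where "e j = 1 + m j * x j" for j
  define l where "l j = [:1, m j:]" for j
  have lN: "(l j)\<^sup>2 - D = - ([:d3:] * ([:0, 1:] * [:-x j, 1:] * [:-x (Suc j), 1:]))" for j
    unfolding l_def D_def using secant_line_divisor[OF sec1 sec2] .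
  have lu: "poly (l j) (x j) = e j" for j by (simp add: l_def e_def mult.commute)
  have lv: "poly (l j) (x (Suc j)) = - e (Suc j)" for j
    using turn[of j] by (simp add: l_def e_def algebra_simps eq_neg_iff_add_eq_0)
  have Dx: "poly D (x j) = (e j)\<^sup>2" for j
    using arg_cong[OF lN[of j], of "\<lambda>p. poly p (x j)"] lu[of j] by (simp add: algebra_simps)
  define z where "z j = [:-x j, 1:]" for j
  have pz: "poly (z j) t = t - x j" for j t by (simp add: z_def)
  have z0: "z j \<noteq> 0" for j by (simp add: z_def)
  have "\<exists>P Q S T c. c \<noteq> 0 \<and> P\<^sup>2 - Q\<^sup>2 * D = monom c k * z 0 * z k \<and> poly P 0 \<noteq> poly Q 0 \<and>
      poly P (x k) = poly Q (x k) * e k \<and> poly S (x k) = poly T (x k) * e k \<and>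
      T * z 0 = P + [:e 0:] * Q \<and> S * z 0 = [:e 0:] * P + Q * D" for k
  proof (induction k)
    case 0
    show ?case
      by (rule exI[of _ "z 0"], rule exI[of _ 0], rule exI[of _ "[:e 0:]"], rule exI[of _ 1], rule exI[of _ 1])
         (simp add: z_def nz power2_eq_square monom_0)
  next
    case (Suc k)
    then obtain P Q S T c where c: "c \<noteq> 0" and N: "P\<^sup>2 - Q\<^sup>2 * D = monom c k * z 0 * z k"
      and ne: "poly P 0 \<noteq> poly Q 0"
      and P: "poly P (x k) = poly Q (x k) * e k" and S: "poly S (x k) = poly T (x k) * e k"
      and TP: "T * z 0 = P + [:e 0:] * Q" and SP: "S * z 0 = [:e 0:] * P + Q * D" by blast
    obtain P' Q' where P': "z k * P' = Q * D - P * l k" and Q': "z k * Q' = P - Q * l k"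
      and PQ': "poly P' (x (Suc k)) = poly Q' (x (Suc k)) * e (Suc k)"
      using secant_step[OF P lu lv Dx Dx step] unfolding z_def by blast
    obtain S' T' where S': "z k * S' = T * D - S * l k" and T': "z k * T' = S - T * l k"
      and ST': "poly S' (x (Suc k)) = poly T' (x (Suc k)) * e (Suc k)"
      using secant_step[OF S lu lv Dx Dx step] unfolding z_def by blast
    have "z k ^ 2 * (P'\<^sup>2 - Q'\<^sup>2 * D) = (z k * P')\<^sup>2 - (z k * Q')\<^sup>2 * D"
      by (simp add: power2_eq_square algebra_simps)
    also have "\<dots> = (P\<^sup>2 - Q\<^sup>2 * D) * ((l k)\<^sup>2 - D)"
      unfolding P' Q' by (simp add: power2_eq_square algebra_simps)
    also have "\<dots> = z k ^ 2 * (monom (- d3 * c) (Suc k) * z 0 * z (Suc k))"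
    proof -
      have "monom (- d3 * c) (Suc k) = - ([:d3:] * [:0, 1:] * monom c k)"
        by (simp add: monom_Suc smult_monom minus_monom)
      then show ?thesis unfolding N lN z_def[symmetric] by (simp only: power2_eq_square mult_minus_left mult_minus_right mult_ac)
    qed
    finally have N': "P'\<^sup>2 - Q'\<^sup>2 * D = monom (- d3 * c) (Suc k) * z 0 * z (Suc k)"
      using z0[of k] by simp
    (* The product does not vanish at (0, -1), since the line l k passes through (0, 1). *)
    have ne': "poly P' 0 \<noteq> poly Q' 0"
      using arg_cong[OF P', of "\<lambda>p. poly p 0"] arg_cong[OF Q', of "\<lambda>p. poly p 0"] ne
      by (auto simp: z_def D_def l_def)
    have "z k * (T' * z 0) = z k * (P' + [:e 0:] * Q')"
    proof -
      have "z k * (T' * z 0) = S * z 0 - T * z 0 * l k"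
        using arg_cong[OF T', of "\<lambda>p. p * z 0"] by (simp add: algebra_simps)
      also have "\<dots> = z k * P' + [:e 0:] * (z k * Q')"
        unfolding TP SP P' Q' by (simp add: algebra_simps )
      finally show ?thesis by (simp add: algebra_simps)
    qed
    then have TP': "T' * z 0 = P' + [:e 0:] * Q'" using z0[of k] by simp
    have "z k * (S' * z 0) = z k * ([:e 0:] * P' + Q' * D)"
    proof -
      have "z k * (S' * z 0) = T * z 0 * D - S * z 0 * l k"
        using arg_cong[OF S', of "\<lambda>p. p * z 0"] by (simp add: algebra_simps)
      also have "\<dots> = [:e 0:] * (z k * P') + (z k * Q') * D"
        unfolding TP SP P' Q' by (simp add: algebra_simps )
      finally show ?thesis by (simp add: algebra_simps)
    qed
    then have SP': "S' * z 0 = [:e 0:] * P' + Q' * D" using z0[of k] by simp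
    from c d3 have "- d3 * c \<noteq> 0" by simp
    with N' ne' PQ' ST' TP' SP' show ?case by blast
  qed

  from this[of n] obtain P Q S T c where c: "c \<noteq> 0" and N: "P\<^sup>2 - Q\<^sup>2 * D = monom c n * z 0 * z 0"
    and ne: "poly P 0 \<noteq> poly Q 0"
    and P: "poly P (x 0) = poly Q (x 0) * e 0" and S: "poly S (x 0) = poly T (x 0) * e 0"
    and TP: "T * z 0 = P + [:e 0:] * Q" and SP: "S * z 0 = [:e 0:] * P + Q * D"
    using closed by (auto simp: e_def z_def)
  have P2: "poly P (x 0) = - e 0 * poly Q (x 0)"
    using arg_cong[OF TP, of "\<lambda>p. poly p (x 0)"] by (simp add: pz eq_neg_iff_add_eq_0)
  have eQ: "e 0 * poly Q (x 0) = 0" using P P2 by (simp add: mult.commute)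
  then have P0: "poly P (x 0) = 0" using P2 by simp
  (* If e 0 = 0, then z - x 0 vanishes doubly at the point and S + T y gives the missing order. *)
  have Q0: "poly Q (x 0) = 0"
  proof (cases "e 0 = 0")
    case False with eQ show ?thesis by simp
  next
    case True
    then have "poly D (x 0) = 0" using Dx[of 0] by simp
    then obtain E where E: "D = z 0 * E" unfolding z_def by (metis poly_eq_0_iff_dvd dvdE)
    have "poly E (x 0) \<noteq> 0"
    proof
      assume "poly E (x 0) = 0"
      then have "poly D (x 0) = 0 \<and> poly (pderiv D) (x 0) = 0"
        unfolding E by (simp add: pderiv_mult pz)
      with simple show False unfolding rsquarefree_roots by blast
    qed
    moreover have "z 0 * S = z 0 * (Q * E)" using SP True E by (simp add: mult_ac)
    then have "S = Q * E" using z0[of 0] by simp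
    moreover have "poly S (x 0) = 0" using S True by simp
    ultimately show ?thesis by simp
  qed
  obtain P' Q' where P': "P = z 0 * P'" and Q': "Q = z 0 * Q'"
    using P0 Q0 unfolding z_def by (metis poly_eq_0_iff_dvd dvdE)
  have "z 0 ^ 2 * (P'\<^sup>2 - Q'\<^sup>2 * D) = z 0 ^ 2 * monom c n"
    using N unfolding P' Q' by (simp add: power2_eq_square algebra_simps)
  then have "P'\<^sup>2 - Q'\<^sup>2 * D = monom c n" using z0[of 0] by simp
  moreover have "poly P' 0 \<noteq> poly Q' 0" using ne unfolding P' Q' by auto
  ultimately show ?thesis using that c by blast
qed

section \<open>Diagonal conics\<close>

definition form :: "complex^3 \<Rightarrow> complex^3 \<Rightarrow> complex^3 \<Rightarrow> complex" where
  "form g u v = g$1 * u$1 * v$1 + g$2 * u$2 * v$2 + g$3 * u$3 * v$3"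

text \<open>The dual conic: for nonzero entries of \<open>g\<close>, the lines with this form zero are the tangents.\<close>

definition dual_form :: "complex^3 \<Rightarrow> complex^3 \<Rightarrow> complex" where
  "dual_form g l = (l$1)\<^sup>2 / g$1 + (l$2)\<^sup>2 / g$2 + (l$3)\<^sup>2 / g$3"

definition cross :: "complex^3 \<Rightarrow> complex^3 \<Rightarrow> complex^3" where
  "cross u v = vector [u$2 * v$3 - u$3 * v$2, u$3 * v$1 - u$1 * v$3, u$1 * v$2 - u$2 * v$1]"

lemma cross_nth:
  "cross u v $ 1 = u$2 * v$3 - u$3 * v$2" "cross u v $ 2 = u$3 * v$1 - u$1 * v$3"
  "cross u v $ 3 = u$1 * v$2 - u$2 * v$1"
  by (simp_all add: cross_def)

lemma bil_eq: "bil u v = u$1 * v$1 + u$2 * v$2 + u$3 * v$3"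
  by (simp add: bil_def sum_3)

lemma vec3_eq_iff: "u = v \<longleftrightarrow> u$1 = v$1 \<and> u$2 = v$2 \<and> u$3 = v$3" for u v :: "complex^3"
  by (simp add: Finite_Cartesian_Product.vec_eq_iff forall_3)

lemma cross_eq_0_iff:
  assumes "u \<noteq> 0"
  shows "cross u v = 0 \<longleftrightarrow> (\<exists>k. v = k *s u)"
proof
  assume L: "cross u v = 0"
  from assms consider "u$1 \<noteq> 0" | "u$2 \<noteq> 0" | "u$3 \<noteq> 0" by (auto simp: vec3_eq_iff)
  then show "\<exists>k. v = k *s u"
  proof cases
    case 1 with L show ?thesis
      by (intro exI[of _ "v$1 / u$1"]) (simp add: vec3_eq_iff cross_nth field_simps)
  next
    case 2 with L show ?thesis
      by (intro exI[of _ "v$2 / u$2"]) (simp add: vec3_eq_iff cross_nth field_simps)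
  next
    case 3 with L show ?thesis
      by (intro exI[of _ "v$3 / u$3"]) (simp add: vec3_eq_iff cross_nth field_simps)
  qed
qed (auto simp: vec3_eq_iff cross_nth)

lemma cross_eq_0_iff_proportional:
  assumes "u \<noteq> 0" "v \<noteq> 0"
  shows "cross u v = 0 \<longleftrightarrow> proportional u v"
  using assms by (simp add: cross_eq_0_iff proportional_def)

lemma cross_swap: "cross v u = - cross u v"
  by (simp add: vec3_eq_iff cross_nth)

lemma bil_cross: "bil u (cross u v) = 0" "bil v (cross u v) = 0"
  by (simp_all add: bil_eq cross_nth algebra_simps)

lemma bil_scale: "bil u (k *s v) = k * bil u v"
  by (simp add: bil_eq algebra_simps)

text \<open>Each coordinate of the cross product gives an instance of Cramer's rule; one of them is nonzero.\<close>

lemma span_if_coplanar: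
  assumes "cross u v \<noteq> 0" "bil w (cross u v) = 0"
  obtains s t where "w = s *s u + t *s v"
proof -
  have e: "w$1 * cross u v $ 1 + w$2 * cross u v $ 2 + w$3 * cross u v $ 3 = 0"
    using assms(2) by (simp add: bil_eq)
  have *: "cross u v $ i *s w = cross w v $ i *s u + cross u w $ i *s v" for i
  proof -
    have "\<forall>i. cross u v $ i *s w = cross w v $ i *s u + cross u w $ i *s v"
      unfolding forall_3 vec3_eq_iff using e
      by (simp add: cross_nth) (intro conjI; Groebner_Basis.algebra)
    then show ?thesis ..
  qed
  obtain i where i: "cross u v $ i \<noteq> 0" using assms(1) by (auto simp: Finite_Cartesian_Product.vec_eq_iff)
  have "w = (cross w v $ i / cross u v $ i) *s u + (cross u w $ i / cross u v $ i) *s v"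
    using *[of i] i by (simp add: vec3_eq_iff field_simps)
  then show ?thesis using that by blast
qed

lemma perpendicular_unique:
  assumes "cross u v \<noteq> 0" "bil u l = 0" "bil v l = 0"
  obtains k where "l = k *s cross u v"
proof -
  have "cross (cross u v) l = 0"
    using assms(2,3) unfolding vec3_eq_iff cross_nth bil_eq by (simp, intro conjI) Groebner_Basis.algebra+
  then show ?thesis using assms(1) that by (auto simp: cross_eq_0_iff)
qed

lemma form_add_right: "form g u (s *s v + t *s w) = s * form g u v + t * form g u w"
  by (simp add: form_def algebra_simps)

lemma form_commute: "form g u v = form g v u"
  by (simp add: form_def mult_ac)

lemma form_eq_bil: "form g u v = bil u (g * v)"
  by (simp add: form_def bil_eq mult_ac)

definition nondegenerate :: "complex^3 \<Rightarrow> bool" where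
  "nondegenerate g \<longleftrightarrow> g$1 \<noteq> 0 \<and> g$2 \<noteq> 0 \<and> g$3 \<noteq> 0"

text \<open>A smooth conic contains no line. With \<open>l = cross u v\<close>, all three products of \<open>u, v\<close> being zero makes
the polars \<open>g * u\<close> and \<open>g * v\<close> parallel to \<open>l\<close>; so they are parallel to each other unless \<open>l = 0\<close>,
and \<open>g\<close> is invertible.\<close>

lemma conjugate_isotropic_imp_parallel:
  assumes g: "nondegenerate g" and "form g u u = 0" "form g v v = 0" "form g u v = 0"
  shows "cross u v = 0"
proof -
  let ?L = "cross u v"
  have u: "cross ?L (g * u) = 0" and v: "cross ?L (g * v) = 0"
    using assms(2-) unfolding vec3_eq_iff cross_nth form_def by (simp_all, (intro conjI; Groebner_Basis.algebra)+)
  have *: "?L$i * (g * u)$j = ?L$j * (g * u)$i \<and> ?L$i * (g * v)$j = ?L$j * (g * v)$i" for i j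
  proof -
    have "\<forall>i j. ?L$i * (g * u)$j = ?L$j * (g * u)$i \<and> ?L$i * (g * v)$j = ?L$j * (g * v)$i"
      using u v unfolding forall_3 vec3_eq_iff cross_nth(1-3)[of ?L] by simp
    then show ?thesis by blast
  qed
  have z: "(?L$i)\<^sup>2 * ((g * u)$j * (g * v)$k - (g * u)$k * (g * v)$j) = 0" for i j k
    using *[of i j] *[of i k] by Groebner_Basis.algebra
  have "(?L$1)\<^sup>2 * (g$2 * g$3 * ?L$1) = 0" "(?L$2)\<^sup>2 * (g$3 * g$1 * ?L$2) = 0"
    "(?L$3)\<^sup>2 * (g$1 * g$2 * ?L$3) = 0"
    using z[of 1 2 3] z[of 2 3 1] z[of 3 1 2] by (simp_all add: cross_nth algebra_simps)
  then show ?thesis using g by (simp add: vec3_eq_iff nondegenerate_def)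
qed

text \<open>On the line spanned by two points \<open>u, v\<close> of the conic, the form of \<open>s u + t v\<close> is a nonzero multiple of
\<open>s t\<close>.\<close>

lemma line_meets_conic_twice:
  assumes g: "nondegenerate g" and "form g u u = 0" "form g v v = 0" "form g w w = 0"
    and uv: "cross u v \<noteq> 0" and w: "bil w (cross u v) = 0"
  shows "cross u w = 0 \<or> cross v w = 0"
proof -
  obtain s t where st: "w = s *s u + t *s v" using span_if_coplanar[OF uv w] .
  have "form g w w = 2 * s * t * form g u v"
    using assms(2,3) unfolding st form_add_right
    by (simp add: form_commute[of g "s *s u + t *s v"] form_add_right form_commute[of g v u] algebra_simps)
  moreover have "form g u v \<noteq> 0"
    using conjugate_isotropic_imp_parallel[OF g assms(2,3)] uv by blast
  ultimately have "s = 0 \<or> t = 0" using assms(4) by simp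
  then show ?thesis unfolding st by (auto simp: vec3_eq_iff cross_nth)
qed

lemma dual_form_pole:
  assumes "nondegenerate c"
  shows "dual_form c (c * q) = form c q q"
  using assms by (simp add: dual_form_def form_def nondegenerate_def power2_eq_square field_simps)

text \<open>A tangent line is the polar of its point of contact \<open>q\<close>; if it passes through the point \<open>p\<close> of the
conic, then \<open>p\<close> and \<open>q\<close> are conjugate, hence equal.\<close>

lemma tangent_at_conic_point:
  assumes c: "nondegenerate c" and "form c p p = 0" "dual_form c l = 0" "bil p l = 0" "p \<noteq> 0"
  obtains k where "l = k *s (c * p)"
proof -
  define q where "q = (\<chi> i. l$i / c$i)"
  have l: "l = c * q" using c by (simp add: q_def vec3_eq_iff nondegenerate_def)
  have "form c q q = 0" using assms(3) unfolding l dual_form_pole[OF c] .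
  moreover have "form c p q = 0" using assms(4) unfolding l form_eq_bil .
  ultimately have "cross p q = 0" using conjugate_isotropic_imp_parallel[OF c] assms(2) by blast
  then obtain k where "q = k *s p" using assms(5) by (auto simp: cross_eq_0_iff)
  then have "l = k *s (c * p)" unfolding l by (simp add: vec3_eq_iff)
  then show ?thesis using that by blast
qed

lemma form_scale: "form g (r *s u) (t *s v) = r * t * form g u v"
  by (simp add: form_def algebra_simps)

lemma cross_scale: "cross (r *s u) (t *s v) = (r * t) *s cross u v"
  by (simp add: vec3_eq_iff cross_nth algebra_simps)

lemma dual_form_scale: "dual_form c (r *s l) = r\<^sup>2 * dual_form c l"
  by (simp add: dual_form_def power_mult_distrib distrib_left)

lemma form_mult: "form c (b * x) (b * y) = form (c * b * b) x y"
  by (simp add: form_def mult_ac)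

lemma dual_form_mult:
  assumes "nondegenerate c" "nondegenerate b"
  shows "dual_form c (cross (b * x) (b * y)) = (b$1 * b$2 * b$3)\<^sup>2 * dual_form (c * b * b) (cross x y)"
  using assms by (simp add: dual_form_def nondegenerate_def cross_nth distrib_left power2_eq_square)
    (simp add: field_simps)

section \<open>Parametrising a conic from a base point of the pencil\<close>

text \<open>The forms \<open>base_weight \<alpha>\<close> and \<open>\<alpha> * base_weight \<alpha>\<close> vanish at \<open>(1, 1, 1)\<close>; every pair of diagonal conics
\<open>c\<close> and \<open>\<alpha> * c\<close> becomes this one after dividing the coordinates by those of a common point.\<close>

definition base_weight :: "complex^3 \<Rightarrow> complex^3" where
  "base_weight \<alpha> = vector [\<alpha>$2 - \<alpha>$3, \<alpha>$3 - \<alpha>$1, \<alpha>$1 - \<alpha>$2]"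

text \<open>The elementary symmetric functions are the coefficients of the cubic
\<open>(1 + \<alpha>_1 z) (1 + \<alpha>_2 z) (1 + \<alpha>_3 z)\<close>, up to a constant the determinant of the
pencil.\<close>

definition esym1 :: "complex^3 \<Rightarrow> complex" where "esym1 \<alpha> = \<alpha>$1 + \<alpha>$2 + \<alpha>$3"
definition esym2 :: "complex^3 \<Rightarrow> complex" where "esym2 \<alpha> = \<alpha>$1 * \<alpha>$2 + \<alpha>$1 * \<alpha>$3 + \<alpha>$2 * \<alpha>$3"
definition esym3 :: "complex^3 \<Rightarrow> complex" where "esym3 \<alpha> = \<alpha>$1 * \<alpha>$2 * \<alpha>$3"

text \<open>This is the Vandermonde product of \<open>\<alpha>\<close> up to sign; its being nonzero says that \<open>\<alpha>_1, \<alpha>_2, \<alpha>_3\<close> are distinct.\<close>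

definition weight_prod :: "complex^3 \<Rightarrow> complex" where
  "weight_prod \<alpha> = base_weight \<alpha> $ 1 * base_weight \<alpha> $ 2 * base_weight \<alpha> $ 3"

text \<open>The second intersection of the conic \<open>\<alpha> * base_weight \<alpha>\<close> with the line through the base point
\<open>(1, 1, 1)\<close> that touches there the member \<open>base_weight \<alpha> + z (\<alpha> * base_weight \<alpha>)\<close> of the pencil.\<close>

definition conic_param :: "complex^3 \<Rightarrow> complex \<Rightarrow> complex^3" where
  "conic_param \<alpha> z = vector
     [esym3 \<alpha> * z\<^sup>2 + 2 * \<alpha>$2 * \<alpha>$3 * z + (esym1 \<alpha> - 2 * \<alpha>$1),
      esym3 \<alpha> * z\<^sup>2 + 2 * \<alpha>$1 * \<alpha>$3 * z + (esym1 \<alpha> - 2 * \<alpha>$2),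
      esym3 \<alpha> * z\<^sup>2 + 2 * \<alpha>$1 * \<alpha>$2 * z + (esym1 \<alpha> - 2 * \<alpha>$3)]"

text \<open>Eliminating \<open>m\<close> from \<open>2 m = d1 - d3 z s\<close> and \<open>m\<^sup>2 = d2 + d3 (z + s)\<close>, the conditions for a secant of
the cubic through \<open>(0, 1)\<close>, gives this symmetric biquadratic equation.\<close>

definition chord_biquad :: "complex^3 \<Rightarrow> complex \<Rightarrow> complex \<Rightarrow> complex" where
  "chord_biquad \<alpha> z s = (esym1 \<alpha> - esym3 \<alpha> * z * s)\<^sup>2 - 4 * (esym2 \<alpha> + esym3 \<alpha> * (z + s))"

lemmas param_defs = base_weight_def esym1_def esym2_def esym3_def weight_prod_def conic_param_def chord_biquad_def

lemma base_weight_nth: "base_weight \<alpha> $ 1 = \<alpha>$2 - \<alpha>$3" "base_weight \<alpha> $ 2 = \<alpha>$3 - \<alpha>$1" "base_weight \<alpha> $ 3 = \<alpha>$1 - \<alpha>$2"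
  by (simp_all add: base_weight_def)

text \<open>No two distinct points of a smooth conic are conjugate, and the polar of a point touches the conic there:
hence the double zero at \<open>z = s\<close>.\<close>

lemma form_conic_param:
  "form (\<alpha> * base_weight \<alpha>) (conic_param \<alpha> z) (conic_param \<alpha> s) = 2 * esym3 \<alpha> * weight_prod \<alpha> * (z - s)\<^sup>2"
  by (simp add: form_def param_defs) Groebner_Basis.algebra

lemma base_form_conic_param:
  "form (base_weight \<alpha>) 1 (conic_param \<alpha> z) = - 2 * weight_prod \<alpha> * z"
  "form (\<alpha> * base_weight \<alpha>) 1 (conic_param \<alpha> z) = 2 * weight_prod \<alpha>"
  by (simp_all add: form_def param_defs, Groebner_Basis.algebra+)

text \<open>The chord of the parameters \<open>z\<close> and \<open>s\<close> touches the conic \<open>base_weight \<alpha>\<close> if the biquadratic vanishes: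
this identifies the sides of the polygons with secants of the cubic.\<close>

lemma dual_form_chord:
  assumes "weight_prod \<alpha> \<noteq> 0"
  shows "dual_form (base_weight \<alpha>) (cross (conic_param \<alpha> z) (conic_param \<alpha> s)) =
    - 4 * weight_prod \<alpha> * (z - s)\<^sup>2 * chord_biquad \<alpha> z s"
proof -
  have d: "base_weight \<alpha> $ 1 \<noteq> 0" "base_weight \<alpha> $ 2 \<noteq> 0" "base_weight \<alpha> $ 3 \<noteq> 0"
    using assms by (auto simp: weight_prod_def)
  define l where "l i = \<alpha>$i * (esym1 \<alpha> - 2 * \<alpha>$i) + esym3 \<alpha> * (z + s) + esym3 \<alpha> * \<alpha>$i * z * s" for i
  have L: "cross (conic_param \<alpha> z) (conic_param \<alpha> s) $ 1 = base_weight \<alpha> $ 1 * (2 * (z - s) * l 1)"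
    "cross (conic_param \<alpha> z) (conic_param \<alpha> s) $ 2 = base_weight \<alpha> $ 2 * (2 * (z - s) * l 2)"
    "cross (conic_param \<alpha> z) (conic_param \<alpha> s) $ 3 = base_weight \<alpha> $ 3 * (2 * (z - s) * l 3)"
    unfolding l_def cross_nth by (simp_all add: param_defs, Groebner_Basis.algebra+)
  have sq: "(w * t)\<^sup>2 / w = w * t\<^sup>2" if "w \<noteq> 0" for w t :: complex
    using that by (simp add: power2_eq_square)
  show ?thesis unfolding dual_form_def L sq[OF d(1)] sq[OF d(2)] sq[OF d(3)] l_def
    by (simp add: param_defs) Groebner_Basis.algebra
qed

lemma dual_form_tangent:
  assumes "weight_prod \<alpha> \<noteq> 0"
  shows "dual_form (base_weight \<alpha>) (\<alpha> * base_weight \<alpha> * conic_param \<alpha> z) = - weight_prod \<alpha> * chord_biquad \<alpha> z z"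
proof -
  have d: "base_weight \<alpha> $ 1 \<noteq> 0" "base_weight \<alpha> $ 2 \<noteq> 0" "base_weight \<alpha> $ 3 \<noteq> 0"
    using assms by (auto simp: weight_prod_def)
  have sq: "(a * w * t)\<^sup>2 / w = w * (a * t)\<^sup>2" if "w \<noteq> 0" for a w t :: complex
    using that by (simp add: power2_eq_square)
  show ?thesis
    unfolding dual_form_def vector_mult_component sq[OF d(1)] sq[OF d(2)] sq[OF d(3)]
    by (simp add: param_defs) Groebner_Basis.algebra
qed

text \<open>The parameter is \<open>- N / E\<close>, where \<open>N\<close> and \<open>E\<close> are the values at \<open>x\<close> of the polars of the base point with
respect to the two conics. Together with the equation of the conic they determine \<open>x\<close> by \<open>id\<close>, unless
\<open>N = E = 0\<close>, which happens only at the base point.\<close>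

lemma conic_param_surj:
  assumes d: "weight_prod \<alpha> \<noteq> 0" and e: "esym3 \<alpha> \<noteq> 0"
    and x: "form (\<alpha> * base_weight \<alpha>) x x = 0" "\<not> (\<exists>k. x = k *s 1)"
  obtains k z where "x = k *s conic_param \<alpha> z"
proof -
  define N E where "N = form (base_weight \<alpha>) 1 x" and "E = form (\<alpha> * base_weight \<alpha>) 1 x"
  have id: "2 * weight_prod \<alpha> * E * x$1 = esym3 \<alpha> * N\<^sup>2 - 2 * \<alpha>$2 * \<alpha>$3 * N * E + (esym1 \<alpha> - 2 * \<alpha>$1) * E\<^sup>2"
    "2 * weight_prod \<alpha> * E * x$2 = esym3 \<alpha> * N\<^sup>2 - 2 * \<alpha>$1 * \<alpha>$3 * N * E + (esym1 \<alpha> - 2 * \<alpha>$2) * E\<^sup>2"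
    "2 * weight_prod \<alpha> * E * x$3 = esym3 \<alpha> * N\<^sup>2 - 2 * \<alpha>$1 * \<alpha>$2 * N * E + (esym1 \<alpha> - 2 * \<alpha>$3) * E\<^sup>2"
    using x(1) by (simp_all add: N_def E_def form_def param_defs, Groebner_Basis.algebra+)
  have E: "E \<noteq> 0"
  proof
    assume E0: "E = 0"
    then have N0: "N = 0" using id(1) e by simp
    have "(\<alpha>$2 - \<alpha>$3) * ((\<alpha>$3 - \<alpha>$1) * (x$2 - x$1)) = 0"
      "(\<alpha>$2 - \<alpha>$3) * ((\<alpha>$1 - \<alpha>$2) * (x$3 - x$1)) = 0"
      using E0 N0 by (simp_all add: N_def E_def form_def param_defs, Groebner_Basis.algebra+)
    then have "x$2 = x$1" "x$3 = x$1" using d by (auto simp: weight_prod_def base_weight_nth)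
    then have "x = x$1 *s 1" by (simp add: vec3_eq_iff)
    with x(2) show False by blast
  qed
  have "x = (E / (2 * weight_prod \<alpha>)) *s conic_param \<alpha> (- N / E)"
  proof -
    have *: "y = E / (2 * weight_prod \<alpha>) * (a * (- N / E)\<^sup>2 + 2 * b * (- N / E) + c)"
      if "2 * weight_prod \<alpha> * E * y = a * N\<^sup>2 - 2 * b * N * E + c * E\<^sup>2" for y a b c
    proof -
      define t where "t = - N / E"
      have "N = - E * t" using E by (simp add: t_def)
      then have "E * (2 * weight_prod \<alpha> * y) = E * (E * (a * t\<^sup>2 + 2 * b * t + c))"
        using that by Groebner_Basis.algebra
      then have "E * (a * (- N / E)\<^sup>2 + 2 * b * (- N / E) + c) = 2 * weight_prod \<alpha> * y"
        using E by (simp add: t_def)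
      then show ?thesis using d by (simp add: field_simps)
    qed
    show ?thesis
      using *[OF id(1)[unfolded mult.assoc[of 2 "\<alpha>$2" "\<alpha>$3"]]]
        *[OF id(2)[unfolded mult.assoc[of 2 "\<alpha>$1" "\<alpha>$3"]]]
        *[OF id(3)[unfolded mult.assoc[of 2 "\<alpha>$1" "\<alpha>$2"]]]
      by (simp add: vec3_eq_iff conic_param_def mult.assoc)
  qed
  then show ?thesis using that by blast
qed

section \<open>Polygons inscribed in one conic and circumscribed about another\<close>

text \<open>Two mirror symmetries of a sequence with least period \<open>d\<close> compose to the translation by twice the
distance of their centres, so this distance is an odd multiple of \<open>d/2\<close> if the values at the centres
differ. For three centres the sum of two odd multiples would again be odd.\<close>

lemma at_most_two_mirrors:
  fixes v :: "int \<Rightarrow> 'a" and n :: int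
  assumes n: "n > 0" "\<And>j. v (j + n) = v j"
    and mirror: "\<And>i k. i \<in> {i1, i2, i3} \<Longrightarrow> v (i + k) = v (i - k)"
    and distinct: "v i1 \<noteq> v i2" "v i1 \<noteq> v i3" "v i2 \<noteq> v i3"
  shows False
proof -
  define per where "per m \<longleftrightarrow> (\<forall>j. v (j + m) = v j)" for m
  have per_add: "per (l + m)" if "per l" "per m" for l m
    using that unfolding per_def by (metis add.assoc)
  have per_neg: "per (- m)" if "per m" for m
    unfolding per_def by (metis that add.commute add_uminus_conv_diff diff_add_cancel per_def)
  have per_diff: "per (l - m)" if "per l" "per m" for l m
    using per_add[OF that(1) per_neg[OF that(2)]] by simp
  have per_mult: "per (int q * m)" if "per m" for q m
  proof (induction q)
    case (Suc q)
    then show ?case using per_add[OF Suc that] by (simp add: distrib_right add.commute)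
  qed (simp add: per_def)
  have per_mult': "per (q * m)" if "per m" for q m
    using per_mult[OF that, of "nat \<bar>q\<bar>"] per_neg[of "\<bar>q\<bar> * m"] by (cases "q \<ge> 0") auto
  have "\<exists>d. d > 0 \<and> per (int d)" using n by (intro exI[of _ "nat n"]) (simp add: per_def)
  define d where "d = int (LEAST d. d > 0 \<and> per (int d))"
  have d: "d > 0" "per d"
    using LeastI_ex[OF \<open>\<exists>d. d > 0 \<and> per (int d)\<close>] by (simp_all add: d_def)
  have min: "d \<le> m" if "m > 0" "per m" for m
    using Least_le[of "\<lambda>d. d > 0 \<and> per (int d)" "nat m"] that by (simp add: d_def)
  have dvd: "d dvd m" if "per m" for m
  proof -
    have "m mod d = m - m div d * d" by (simp add: minus_div_mult_eq_mod)
    then have "per (m mod d)" using per_diff[OF that per_mult'[OF d(2)]] by simp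
    then have "m mod d = 0" using min[of "m mod d"] d(1) pos_mod_sign[of d m] pos_mod_bound[of d m] by fastforce
    then show ?thesis by auto
  qed
  have twice: "d dvd 2 * (j - i)" if "i \<in> {i1, i2, i3}" "j \<in> {i1, i2, i3}" for i j
  proof (rule dvd)
    have "v (k + 2 * (j - i)) = v k" for k
      using mirror[OF that(1), of "k - i"] mirror[OF that(2), of "j - 2 * i + k"]
      by (simp add: algebra_simps)
    then show "per (2 * (j - i))" by (simp add: per_def)
  qed
  have not_dvd: "\<not> d dvd j - i" if "v i \<noteq> v j" for i j
  proof
    assume "d dvd j - i"
    then obtain q where "j - i = q * d" by (metis dvd_def mult.commute)
    then have "per (j - i)" using per_mult'[OF d(2)] by simp
    then have "v (i + (j - i)) = v i" unfolding per_def by blast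
    with that show False by simp
  qed
  obtain q where q: "2 * (i2 - i1) = d * q" using twice[of i1 i2] by (auto elim: dvdE)
  obtain r where r: "2 * (i3 - i1) = d * r" using twice[of i1 i3] by (auto elim: dvdE)
  have odd: "odd q" if "2 * (j - i) = d * q" "v i \<noteq> v j" for i j q
  proof
    assume "even q"
    then obtain h where "q = 2 * h" by blast
    then have "j - i = d * h" using that(1) by simp
    then show False using not_dvd[OF that(2)] by simp
  qed
  have "2 * (i3 - i2) = d * (r - q)" using q r by (simp add: algebra_simps)
  then have "odd (r - q)" by (rule odd) (use distinct in simp)
  moreover have "odd q" "odd r" using odd[OF q] odd[OF r] distinct by simp_all
  ultimately show False by simp
qed

text \<open>The inner conic is \<open>diag(c)\<close>, the outer one \<open>diag(g)\<close>. Vertices are chosen representatives of projective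
points, so that parallel vectors \<open>v i\<close> and \<open>v j\<close> are equal. By the last assumption, the tangents to the
inner conic through a vertex are just the two sides there.\<close>

locale circumscribed_polygon =
  fixes c g :: "complex^3" and n :: nat and v :: "int \<Rightarrow> complex^3"
  assumes c: "nondegenerate c" and g: "nondegenerate g" and n: "n > 0"
    and periodic: "v (j + int n) = v j"
    and nonzero: "v j \<noteq> 0" and on_conic: "form g (v j) (v j) = 0"
    and canonical: "cross (v i) (v j) = 0 \<Longrightarrow> v i = v j"
    and successive: "v j \<noteq> v (j + 1)"
    and side_tangent: "dual_form c (cross (v j) (v (j + 1))) = 0"
    and tangent_is_side: "l \<noteq> 0 \<Longrightarrow> bil (v j) l = 0 \<Longrightarrow> dual_form c l = 0 \<Longrightarrow>
      bil (v (j - 1)) l = 0 \<or> bil (v (j + 1)) l = 0"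
begin

lemma side: "cross (v j) (v (j + 1)) \<noteq> 0" "cross (v j) (v (j - 1)) \<noteq> 0"
  using canonical[of j "j + 1"] successive[of j] canonical[of j "j - 1"] successive[of "j - 1"] by auto

lemma side_tangent': "dual_form c (cross (v j) (v (j - 1))) = 0"
  using side_tangent[of "j - 1"] by (subst cross_swap) (simp add: dual_form_def)

text \<open>The polygon is determined by any vertex and the direction of travel: a chord from \<open>v j\<close> that touches
the inner conic ends in a neighbouring vertex.\<close>

lemma chord_neighbour:
  assumes u: "form g u u = 0" and "cross (v j) u \<noteq> 0" and "dual_form c (cross (v j) u) = 0"
  shows "cross (v (j - 1)) u = 0 \<or> cross (v (j + 1)) u = 0"
proof -
  have *: "cross u w = 0" if "form g w w = 0" "bil w (cross (v j) u) = 0" "cross (v j) w \<noteq> 0" for w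
    using line_meets_conic_twice[OF g on_conic u that(1) assms(2) that(2)] that(3) by blast
  have "bil (v (j - 1)) (cross (v j) u) = 0 \<or> bil (v (j + 1)) (cross (v j) u) = 0"
    using tangent_is_side[OF assms(2) bil_cross(1) assms(3)] .
  then show ?thesis
    using *[OF on_conic _ side(1)] *[OF on_conic _ side(2)] cross_swap[of u] by fastforce
qed

lemma neighbours_determined:
  assumes "v i = v j"
  shows "{v (i - 1), v (i + 1)} = {v (j - 1), v (j + 1)}"
proof -
  have sub: "v k \<in> {v (j - 1), v (j + 1)}" if "k = i - 1 \<or> k = i + 1" "v i = v j" for i j k
  proof -
    have "cross (v j) (v k) \<noteq> 0" using that side[of i] by auto
    moreover have "dual_form c (cross (v j) (v k)) = 0"
      using that side_tangent[of i] side_tangent'[of i] by auto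
    ultimately have "cross (v (j - 1)) (v k) = 0 \<or> cross (v (j + 1)) (v k) = 0"
      by (rule chord_neighbour[OF on_conic])
    then show ?thesis using canonical[of "j - 1" k] canonical[of "j + 1" k] by auto
  qed
  show ?thesis
  proof
    show "{v (i - 1), v (i + 1)} \<subseteq> {v (j - 1), v (j + 1)}"
      using sub[OF _ assms, of "i - 1"] sub[OF _ assms, of "i + 1"] by simp
    show "{v (j - 1), v (j + 1)} \<subseteq> {v (i - 1), v (i + 1)}"
      using sub[OF _ assms[symmetric], of "j - 1"] sub[OF _ assms[symmetric], of "j + 1"] by simp
  qed
qed

text \<open>If the polygon turns back at a vertex, it retraces its way, because at every vertex the set of
the two neighbours is determined.\<close>

lemma mirror:
  assumes "v (i - 1) = v (i + 1)"
  shows "v (i + k) = v (i - k)"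
proof -
  have nat: "v (i + int m) = v (i - int m) \<and> v (i + int m + 1) = v (i - int m - 1)" for m
  proof (induction m)
    case (Suc m)
    have "{v (i + int m), v (i + int m + 2)} = {v (i - int m - 2), v (i - int m)}"
      using neighbours_determined[of "i + int m + 1" "i - int m - 1"] Suc by (simp add: algebra_simps)
    then have "v (i + int m + 2) = v (i - int m - 2)" using Suc by (auto simp: doubleton_eq_iff)
    then show ?case using Suc by (simp add: algebra_simps)
  qed (use assms in simp)
  show ?thesis
  proof (cases "k \<ge> 0")
    case True then show ?thesis using nat[of "nat k"] by simp
  next
    case False then show ?thesis using nat[of "nat (- k)"] by simp
  qed
qed

text \<open>Through a common point of both conics there is only one tangent to the inner one, so both sides at
this vertex lie on it and have the same other end.\<close>

lemma mirror_at_base_point: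
  assumes "form c b b = 0" "b \<noteq> 0" "cross b (v i) = 0"
  shows "v (i + k) = v (i - k)"
proof (rule mirror)
  obtain t where t: "v i = t *s b" using cross_eq_0_iff[OF assms(2)] assms(3) by blast
  have "form c (v i) (v i) = t * t * form c b b" by (simp add: t form_def algebra_simps)
  then have ci: "form c (v i) (v i) = 0" using assms(1) by simp
  obtain r where r: "cross (v i) (v (i + 1)) = r *s (c * v i)"
    using tangent_at_conic_point[OF c ci side_tangent bil_cross(1) nonzero] .
  obtain s where s: "cross (v i) (v (i - 1)) = s *s (c * v i)"
    using tangent_at_conic_point[OF c ci side_tangent' bil_cross(1) nonzero] .
  have "s \<noteq> 0" using side(2)[of i] unfolding s by auto
  then have "bil (v (i - 1)) (c * v i) = 0"
    using bil_cross(2)[of "v (i - 1)" "v i"] unfolding s bil_scale by simp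
  then have "bil (v (i - 1)) (cross (v i) (v (i + 1))) = 0"
    unfolding r bil_scale by simp
  then have "cross (v i) (v (i - 1)) = 0 \<or> cross (v (i + 1)) (v (i - 1)) = 0"
    by (rule line_meets_conic_twice[OF g on_conic on_conic on_conic side(1)])
  then show "v (i - 1) = v (i + 1)" using side(2)[of i] canonical[of "i + 1" "i - 1"] by simp
qed

text \<open>A common point of the two conics that occurs as a vertex is a centre of mirror symmetry, and there
are at most two values at such centres.\<close>

lemma base_point_off_orbit:
  assumes b: "\<And>b. b \<in> {b1, b2, b3} \<Longrightarrow> b \<noteq> 0 \<and> form c b b = 0"
    and distinct: "cross b1 b2 \<noteq> 0" "cross b1 b3 \<noteq> 0" "cross b2 b3 \<noteq> 0"
  shows "\<exists>b\<in>{b1, b2, b3}. \<forall>j. cross b (v j) \<noteq> 0"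
proof (rule ccontr)
  assume no: "\<not> ?thesis"
  then have hit: "\<exists>j. cross b (v j) = 0" if "b \<in> {b1, b2, b3}" for b
    using no that by blast
  obtain i1 i2 i3 where i: "cross b1 (v i1) = 0" "cross b2 (v i2) = 0" "cross b3 (v i3) = 0"
    using hit[of b1] hit[of b2] hit[of b3] by auto
  have ne: "v i \<noteq> v j" if h: "cross b (v i) = 0" "cross b' (v j) = 0" "cross b b' \<noteq> 0" "b \<noteq> 0" "b' \<noteq> 0" for b b' i j
  proof
    assume eq: "v i = v j"
    obtain s where s: "v i = s *s b" using cross_eq_0_iff[OF h(4)] h(1) by blast
    obtain t where t: "v i = t *s b'" using cross_eq_0_iff[OF h(5)] h(2) eq by metis
    have "s \<noteq> 0" using nonzero[of i] s by auto
    have "t \<noteq> 0" using nonzero[of i] t by auto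
    have "s *s (t *s cross b b') = cross (s *s b) (t *s b')"
      by (simp add: vec3_eq_iff cross_nth algebra_simps)
    also have "\<dots> = 0" unfolding s[symmetric] t[symmetric] by (simp add: vec3_eq_iff cross_nth)
    finally show False using h(3) \<open>s \<noteq> 0\<close> \<open>t \<noteq> 0\<close> by simp
  qed
  show False
  proof (rule at_most_two_mirrors[of "int n" v i1 i2 i3])
    fix i k assume "i \<in> {i1, i2, i3}"
    then obtain b where "b \<in> {b1, b2, b3}" "cross b (v i) = 0" using i by blast
    then show "v (i + k) = v (i - k)" using b[of b] by (intro mirror_at_base_point) auto
  next
    show "v i1 \<noteq> v i2" by (rule ne[OF i(1,2) distinct(1)]) (simp_all add: b)
    show "v i1 \<noteq> v i3" by (rule ne[OF i(1,3) distinct(2)]) (simp_all add: b)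
    show "v i2 \<noteq> v i3" by (rule ne[OF i(2,3) distinct(3)]) (simp_all add: b)
  qed (simp_all add: n periodic)
qed

end

text \<open>Vieta's formula when the roots are known only as a set, so that \<open>r = s\<close> has to be a double root.\<close>

lemma quadratic_root_sum:
  fixes A B C r s :: complex
  assumes A: "A \<noteq> 0" and roots: "\<And>x. A * x\<^sup>2 + B * x + C = 0 \<longleftrightarrow> x = r \<or> x = s"
  shows "A * (r + s) = - B"
proof -
  define t where "t = - B / A - r"
  have sum: "A * (r + t) = - B" using A by (simp add: t_def)
  have r: "A * r\<^sup>2 + B * r + C = 0" and s: "A * s\<^sup>2 + B * s + C = 0" using roots by blast+
  have "A * t\<^sup>2 + B * t + C = 0" using sum r by Groebner_Basis.algebra
  then consider "t = s" | "t = r" using roots by blast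
  then show ?thesis
  proof cases
    case 2
    then have B: "B = - (2 * A * r)" using sum by (simp add: mult.assoc mult.left_commute)
    have "A * (s - r)\<^sup>2 = (A * s\<^sup>2 + B * s + C) - (A * r\<^sup>2 + B * r + C)"
      unfolding B by (simp add: power2_eq_square algebra_simps)
    then have "A * (s - r)\<^sup>2 = 0" using r s by simp
    then show ?thesis using A sum 2 by simp
  qed (use sum in simp)
qed

text \<open>The roots \<open>- 1/\<alpha>_i\<close> are distinct.\<close>

lemma cubic_rsquarefree:
  assumes d: "weight_prod \<alpha> \<noteq> 0" and e: "esym3 \<alpha> \<noteq> 0"
  shows "rsquarefree [:1, esym1 \<alpha>, esym2 \<alpha>, esym3 \<alpha>:]"
  unfolding rsquarefree_roots
proof (intro allI notI)
  fix z assume z: "poly [:1, esym1 \<alpha>, esym2 \<alpha>, esym3 \<alpha>:] z = 0 \<and> poly (pderiv [:1, esym1 \<alpha>, esym2 \<alpha>, esym3 \<alpha>:]) z = 0"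
  define p where "p i = 1 + \<alpha>$i * z" for i
  have 1: "p 1 * p 2 * p 3 = 0"
    using z by (simp add: p_def esym1_def esym2_def esym3_def) Groebner_Basis.algebra
  have 2: "\<alpha>$1 * p 2 * p 3 + \<alpha>$2 * p 1 * p 3 + \<alpha>$3 * p 1 * p 2 = 0"
    using z by (simp add: p_def esym1_def esym2_def esym3_def pderiv_pCons) Groebner_Basis.algebra
  have "i = j" if "p i = 0" "p j = 0" for i j
  proof -
    have "\<alpha>$i = \<alpha>$j" using that by (simp add: p_def) Groebner_Basis.algebra
    then show ?thesis using d exhaust_3[of i] exhaust_3[of j] by (auto simp: weight_prod_def base_weight_nth)
  qed
  from this[of 1 2] this[of 1 3] this[of 2 3] show False using 1 2 e by (auto simp: esym3_def)
qed

text \<open>The parameters of the vertices, seen from a base point off the polygon, form a closed chain of secants.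
The consecutive ones satisfy the biquadratic equation since the sides are tangents. That consecutive
secants fit together, the condition \<open>turn\<close>, is Vieta's formula: the neighbours of \<open>z j\<close> are all the
roots of \<open>chord_biquad \<alpha> (z j)\<close>, because by \<open>chord_neighbour\<close> any root is the parameter of a neighbour.\<close>

lemma (in circumscribed_polygon) pell:
  assumes \<alpha>: "g = \<alpha> * c" and d: "weight_prod \<alpha> \<noteq> 0" and e: "esym3 \<alpha> \<noteq> 0"
  obtains P Q k where "k \<noteq> 0" "P\<^sup>2 - Q\<^sup>2 * [:1, esym1 \<alpha>, esym2 \<alpha>, esym3 \<alpha>:] = monom k n" "poly P 0 \<noteq> poly Q 0"
proof -
  define r where "r i = csqrt (base_weight \<alpha> $ i / c $ i)" for i
  have w: "base_weight \<alpha> $ i \<noteq> 0" for i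
    using d exhaust_3[of i] by (auto simp: weight_prod_def)
  have c0: "c $ i \<noteq> 0" for i using c exhaust_3[of i] by (auto simp: nondegenerate_def)
  have r: "c $ i * (r i * r i) = base_weight \<alpha> $ i" and r0: "r i \<noteq> 0" for i
  proof -
    have "r i * r i = base_weight \<alpha> $ i / c $ i" unfolding r_def by (metis power2_csqrt power2_eq_square)
    then show "c $ i * (r i * r i) = base_weight \<alpha> $ i" using c0 by simp
    then show "r i \<noteq> 0" using w[of i] by auto
  qed
  define b1 b2 b3 :: "complex^3"
    where "b1 = vector [r 1, r 2, r 3]" and "b2 = vector [- r 1, r 2, r 3]" and "b3 = vector [r 1, - r 2, r 3]"
  note bs = b1_def b2_def b3_def
  have base: "c * b * b = base_weight \<alpha> \<and> nondegenerate b" if "b \<in> {b1, b2, b3}" for b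
    using that r[of 1] r[of 2] r[of 3] r0 by (auto simp: bs vec3_eq_iff nondegenerate_def mult.assoc)
  have base_form: "form c b b = 0" if "c * b * b = base_weight \<alpha>" for b
  proof -
    have "form c b b = (c * b * b)$1 + (c * b * b)$2 + (c * b * b)$3" by (simp add: form_def)
    then show ?thesis unfolding that by (simp add: base_weight_nth)
  qed
  (* At most two of the common points of the two conics are vertices, so three candidates are enough. *)
  have "\<exists>b\<in>{b1, b2, b3}. \<forall>j. cross b (v j) \<noteq> 0"
  proof (rule base_point_off_orbit)
    show "b \<noteq> 0 \<and> form c b b = 0" if "b \<in> {b1, b2, b3}" for b
      using base[OF that] base_form[of b] by (auto simp: nondegenerate_def)
    show "cross b1 b2 \<noteq> 0" "cross b1 b3 \<noteq> 0" "cross b2 b3 \<noteq> 0"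
      using r0 by (auto simp: bs vec3_eq_iff cross_nth)
  qed
  then obtain b where b: "c * b * b = base_weight \<alpha>" "nondegenerate b" and off: "\<And>j. cross b (v j) \<noteq> 0"
    using base by blast
  have b0: "b $ i \<noteq> 0" for i using b(2) exhaust_3[of i] by (auto simp: nondegenerate_def)
  have gb: "g * b * b = \<alpha> * base_weight \<alpha>" unfolding \<alpha> b(1)[symmetric] by (simp add: mult_ac)
  define X where "X z = b * conic_param \<alpha> z" for z
  have gX: "form g (X z) (X s) = 2 * esym3 \<alpha> * weight_prod \<alpha> * (z - s)\<^sup>2" for z s
    unfolding X_def form_mult gb by (rule form_conic_param)
  have cX: "form c b (X z) = - 2 * weight_prod \<alpha> * z" for z
    using base_form_conic_param(1)[of \<alpha> z] form_mult[of c b 1 "conic_param \<alpha> z"]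
    by (simp add: X_def b(1))
  have gbX: "form g b (X z) = 2 * weight_prod \<alpha>" for z
    using base_form_conic_param(2)[of \<alpha> z] form_mult[of g b 1 "conic_param \<alpha> z"]
    by (simp add: X_def gb)
  have X0: "X z \<noteq> 0" for z using gbX[of z] d by (auto simp: form_def)
  have XX: "z = s" if "cross (X z) (X s) = 0" for z s
  proof -
    obtain t where "X s = t *s X z" using cross_eq_0_iff[OF X0] \<open>cross (X z) (X s) = 0\<close> by blast
    then have "form g (X z) (X s) = t * form g (X z) (X z)" using form_scale[of g 1 "X z" t "X z"] by simp
    then show ?thesis using d e by (simp add: gX)
  qed
  have chord: "dual_form c (cross (X z) (X s)) = 0 \<longleftrightarrow> z = s \<or> chord_biquad \<alpha> z s = 0" for z s
    unfolding X_def dual_form_mult[OF c b(2)] b(1) dual_form_chord[OF d] using d b0 by simp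
  have "\<exists>z k. v j = k *s X z" for j
  proof -
    define x where "x = (\<chi> i. v j $ i / b $ i)"
    have vx: "v j = b * x" using b0 by (simp add: x_def Finite_Cartesian_Product.vec_eq_iff)
    have "form (\<alpha> * base_weight \<alpha>) x x = 0" using on_conic[of j] unfolding vx form_mult gb .
    moreover have "\<not> (\<exists>k. x = k *s 1)"
    proof
      assume "\<exists>k. x = k *s 1"
      then obtain k where "x = k *s 1" ..
      then have "cross b (v j) = 0" by (simp add: vx vec3_eq_iff cross_nth algebra_simps)
      with off show False by blast
    qed
    ultimately obtain k z where "x = k *s conic_param \<alpha> z" by (rule conic_param_surj[OF d e])
    then have "v j = k *s X z" by (simp add: vx X_def Finite_Cartesian_Product.vec_eq_iff mult_ac)
    then show ?thesis by blast
  qed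
  then obtain z k where vX: "\<And>j. v j = k j *s X (z j)" by metis
  have k0: "k j \<noteq> 0" for j using nonzero[of j] vX[of j] by auto
  have czero: "cross (v i) (X s) = 0 \<longleftrightarrow> cross (X (z i)) (X s) = 0" for i s
    using cross_scale[of "k i" "X (z i)" 1 "X s"] k0 by (simp add: vX)
  have czero2: "cross (v i) (v j) = 0 \<longleftrightarrow> cross (X (z i)) (X (z j)) = 0" for i j
    using k0 by (simp add: vX cross_scale)
  have refl: "cross u u = 0" for u by (simp add: vec3_eq_iff cross_nth)
  have step: "z j \<noteq> z (j + 1)" for j
    using side(1)[of j] unfolding czero2 by (auto simp: refl)
  have step': "z j \<noteq> z (j - 1)" for j using step[of "j - 1"] by simp
  have tangent: "chord_biquad \<alpha> (z j) (z (j + 1)) = 0" for j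
  proof -
    have "dual_form c (cross (X (z j)) (X (z (j + 1)))) = 0"
      using side_tangent[of j] k0 unfolding vX cross_scale dual_form_scale by simp
    then show ?thesis unfolding chord using step by blast
  qed
  have sym: "chord_biquad \<alpha> x y = chord_biquad \<alpha> y x" for x y by (simp add: chord_biquad_def algebra_simps)
  have tangent': "chord_biquad \<alpha> (z j) (z (j - 1)) = 0" for j
    using tangent[of "j - 1"] by (simp add: sym)
  (* z j = 0 means that the line from b to v j is the tangent at b to the inner conic. It would be
     a side, although b is not a vertex and v j is the only other point of the outer conic on it. *)
  have znz: "z j \<noteq> 0" for j
  proof
    assume 0: "z j = 0"
    have vb: "bil (v i) (c * b) = k i * (- 2 * weight_prod \<alpha> * z i)" for i
      using form_scale[of c "k i" "X (z i)" 1 b] cX[of "z i"]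
      unfolding form_eq_bil[symmetric] vX by (simp add: form_commute)
    have "c * b \<noteq> 0" using b0 c0 by (auto simp: Finite_Cartesian_Product.vec_eq_iff)
    moreover have "dual_form c (c * b) = 0" using dual_form_pole[OF c] base_form[OF b(1)] by simp
    ultimately have "bil (v (j - 1)) (c * b) = 0 \<or> bil (v (j + 1)) (c * b) = 0"
      using tangent_is_side[of "c * b" j] vb[of j] 0 by simp
    then have "z (j - 1) = 0 \<or> z (j + 1) = 0" unfolding vb using k0 d by simp
    then show False using 0 step[of j] step'[of j] by auto
  qed
  (* The tangent to the outer conic at v j is not a side, hence not a tangent of the inner conic. *)
  have no_common_tangent: "chord_biquad \<alpha> (z j) (z j) \<noteq> 0" for j
  proof
    assume 0: "chord_biquad \<alpha> (z j) (z j) = 0"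
    define l where "l = g * X (z j)"
    have vl: "bil (v i) l = k i * (2 * esym3 \<alpha> * weight_prod \<alpha> * (z i - z j)\<^sup>2)" for i
      using form_scale[of g "k i" "X (z i)" 1 "X (z j)"] gX[of "z i" "z j"]
      unfolding l_def form_eq_bil[symmetric] vX by simp
    have "l \<noteq> 0" using vl[of "j + 1"] step[of j] k0[of "j + 1"] d e by (auto simp: bil_eq)
    moreover have "dual_form c l = dual_form (base_weight \<alpha>) (\<alpha> * base_weight \<alpha> * conic_param \<alpha> (z j))"
      using c0 b0 unfolding dual_form_def l_def X_def \<alpha> b(1)[symmetric]
      by (simp add: power2_eq_square)
    then have "dual_form c l = 0" using 0 by (simp add: dual_form_tangent[OF d])
    ultimately have "bil (v (j - 1)) l = 0 \<or> bil (v (j + 1)) l = 0"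
      using tangent_is_side[of l j] vl[of j] by simp
    then show False unfolding vl using k0 d e step[of j] step'[of j] by auto
  qed
  have neighbours: "chord_biquad \<alpha> (z j) s = 0 \<longleftrightarrow> s = z (j - 1) \<or> s = z (j + 1)" for j s
  proof
    assume s: "chord_biquad \<alpha> (z j) s = 0"
    then have "z j \<noteq> s" using no_common_tangent by auto
    have "cross (v j) (X s) \<noteq> 0" using XX[of "z j" s] \<open>z j \<noteq> s\<close> czero by blast
    moreover have "dual_form c (cross (v j) (X s)) = 0"
      using s chord[of "z j" s] cross_scale[of "k j" "X (z j)" 1 "X s"] by (simp add: vX dual_form_scale)
    ultimately have "cross (v (j - 1)) (X s) = 0 \<or> cross (v (j + 1)) (X s) = 0"
      by (rule chord_neighbour[rotated]) (simp add: gX)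
    then show "s = z (j - 1) \<or> s = z (j + 1)" unfolding czero using XX by blast
  qed (use tangent tangent' in auto)
  have root_sum: "(esym3 \<alpha> * z j)\<^sup>2 * (z (j - 1) + z (j + 1)) = 2 * esym1 \<alpha> * esym3 \<alpha> * z j + 4 * esym3 \<alpha>" for j
  proof -
    have "(esym3 \<alpha> * z j)\<^sup>2 * (z (j - 1) + z (j + 1)) = - (- 2 * esym1 \<alpha> * esym3 \<alpha> * z j - 4 * esym3 \<alpha>)"
    proof (rule quadratic_root_sum)
      show "(esym3 \<alpha> * z j)\<^sup>2 \<noteq> 0" using e znz by simp
      fix x
      have "(esym3 \<alpha> * z j)\<^sup>2 * x\<^sup>2 + (- 2 * esym1 \<alpha> * esym3 \<alpha> * z j - 4 * esym3 \<alpha>) * x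
          + ((esym1 \<alpha>)\<^sup>2 - 4 * esym2 \<alpha> - 4 * esym3 \<alpha> * z j) = chord_biquad \<alpha> (z j) x"
        unfolding chord_biquad_def by Groebner_Basis.algebra
      then show "(esym3 \<alpha> * z j)\<^sup>2 * x\<^sup>2 + (- 2 * esym1 \<alpha> * esym3 \<alpha> * z j - 4 * esym3 \<alpha>) * x
          + ((esym1 \<alpha>)\<^sup>2 - 4 * esym2 \<alpha> - 4 * esym3 \<alpha> * z j) = 0 \<longleftrightarrow> x = z (j - 1) \<or> x = z (j + 1)"
        using neighbours by simp
    qed
    then show ?thesis by simp
  qed
  have closed: "z (j + int n) = z j" for j
    using periodic[of j] czero2[of "j + int n" j] XX[of "z (j + int n)" "z j"] refl[of "v j"] by simp
  define m where "m j = (esym1 \<alpha> - esym3 \<alpha> * z j * z (j + 1)) / 2" for j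
  have m2: "2 * m j = esym1 \<alpha> - esym3 \<alpha> * z j * z (j + 1)" for j by (simp add: m_def)
  show ?thesis
  proof (rule closed_chain_imp_pell[where x = "\<lambda>j. z (int j)" and m = "\<lambda>j. m (int j)"])
    fix j
    have S: "int (Suc j) = int j + 1" by simp
    show "2 * m (int j) = esym1 \<alpha> - esym3 \<alpha> * z (int j) * z (int (Suc j))" unfolding S by (rule m2)
    show "(m (int j))\<^sup>2 = esym2 \<alpha> + esym3 \<alpha> * (z (int j) + z (int (Suc j)))"
      using tangent[of "int j"] m2[of "int j"] unfolding S chord_biquad_def by Groebner_Basis.algebra
    have "(2 * esym3 \<alpha> * z (int j + 1)) * ((m (int j) + m (int j + 1)) * z (int j + 1) + 2) = 0"
      using m2[of "int j"] m2[of "int j + 1"] root_sum[of "int j + 1"] by (simp, Groebner_Basis.algebra)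
    then have "(m (int j) + m (int j + 1)) * z (int j + 1) + 2 = 0"
      using e znz[of "int j + 1"] unfolding mult_eq_0_iff by simp
    then show "(m (int j) + m (int (Suc j))) * z (int (Suc j)) = - 2"
      unfolding S by (simp add: eq_neg_iff_add_eq_0)
    show "z (int j) \<noteq> z (int (Suc j))" unfolding S by (rule step)
    show "z (int j) \<noteq> 0" by (rule znz)
  next
    show "z (int n) = z (int 0)" using closed[of 0] by simp
    show "m (int n) = m (int 0)" using closed[of 0] closed[of 1] by (simp add: m_def add.commute)
    show "esym3 \<alpha> \<noteq> 0" by (rule e)
    show "rsquarefree [:1, esym1 \<alpha>, esym2 \<alpha>, esym3 \<alpha>:]" by (rule cubic_rsquarefree[OF d e])
  qed (rule that)
qed

section \<open>Confocal conics in the projective plane\<close>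

lemma rep_cp2_nonzero: "rep_cp2 p \<noteq> 0"
  using Quotient_rep_reflp[OF Quotient_cp2, of p] by (simp add: proportional_def)

lemma abs_rep_cp2: "abs_cp2 (rep_cp2 p) = p"
  by (rule Quotient_abs_rep[OF Quotient_cp2])

lemma proportional_refl: "u \<noteq> 0 \<Longrightarrow> proportional u u"
  by (auto simp: proportional_def intro: exI[of _ 1])

lemma abs_cp2_eq_iff:
  assumes "u \<noteq> 0" "v \<noteq> 0"
  shows "abs_cp2 u = abs_cp2 v \<longleftrightarrow> proportional u v"
  using Quotient_rel[OF Quotient_cp2, of u v] assms by (simp add: proportional_refl)

lemma rep_abs_cp2:
  assumes "u \<noteq> 0"
  obtains k where "k \<noteq> 0" "rep_cp2 (abs_cp2 u) = k *s u"
proof -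
  have "proportional u (rep_cp2 (abs_cp2 u))"
    using abs_cp2_eq_iff[OF assms rep_cp2_nonzero, of "abs_cp2 u"] by (simp add: abs_rep_cp2)
  then show ?thesis using that by (auto simp: proportional_def)
qed

lemma incident_iff: "incident p (abs_cp2 l) \<longleftrightarrow> bil (rep_cp2 p) l = 0" if "l \<noteq> 0"
proof -
  have "incident (abs_cp2 (rep_cp2 p)) (abs_cp2 l) \<longleftrightarrow> bil (rep_cp2 p) l = 0"
    using that by (intro incident.abs_eq proportional_refl rep_cp2_nonzero)
  then show ?thesis by (simp add: abs_rep_cp2)
qed

lemma line_through_eq:
  assumes "p \<noteq> q"
  shows "cross (rep_cp2 p) (rep_cp2 q) \<noteq> 0"
    and "line_through p q = abs_cp2 (cross (rep_cp2 p) (rep_cp2 q))"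
proof -
  let ?L = "cross (rep_cp2 p) (rep_cp2 q)"
  show L: "?L \<noteq> 0"
    using assms abs_cp2_eq_iff[OF rep_cp2_nonzero rep_cp2_nonzero, of p q]
    by (simp add: abs_rep_cp2 cross_eq_0_iff_proportional rep_cp2_nonzero)
  show "line_through p q = abs_cp2 ?L"
    unfolding line_through_def
  proof (rule the_equality)
    show "incident p (abs_cp2 ?L) \<and> incident q (abs_cp2 ?L)"
      by (simp add: incident_iff[OF L] bil_cross)
    fix l assume l: "incident p l \<and> incident q l"
    have "bil (rep_cp2 p) (rep_cp2 l) = 0" "bil (rep_cp2 q) (rep_cp2 l) = 0"
      using l incident_iff[OF rep_cp2_nonzero, of p l] incident_iff[OF rep_cp2_nonzero, of q l]
      by (simp_all add: abs_rep_cp2)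
    then obtain k where "rep_cp2 l = k *s ?L" by (rule perpendicular_unique[OF L])
    then have "proportional ?L (rep_cp2 l)" using L rep_cp2_nonzero by (auto simp: proportional_def)
    then show "l = abs_cp2 ?L"
      using abs_cp2_eq_iff[OF L rep_cp2_nonzero, of l] by (simp add: abs_rep_cp2)
  qed
qed

definition confocal_diag :: "real \<Rightarrow> real \<Rightarrow> complex \<Rightarrow> complex^3" where
  "confocal_diag a b \<mu> = vector [1 / (of_real a - \<mu>), 1 / (of_real b - \<mu>), -1]"

lemma confocal_mult: "confocal a b \<mu> *v u = confocal_diag a b \<mu> * u"
  by (simp add: confocal_def confocal_diag_def vec3_eq_iff matrix_vector_mult_def sum_3)

lemma nondegenerate_confocal: "\<mu> \<notin> {of_real a, of_real b} \<Longrightarrow> nondegenerate (confocal_diag a b \<mu>)"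
  by (auto simp: nondegenerate_def confocal_diag_def)

lemma conic_points_confocal:
  "p \<in> conic_points (confocal a b \<mu>) \<longleftrightarrow>
     form (confocal_diag a b \<mu>) (rep_cp2 p) (rep_cp2 p) = 0"
  by (simp add: conic_points_def confocal_mult form_eq_bil)

text \<open>The point of contact of a line \<open>l\<close> is its pole \<open>q\<close>, with coordinates \<open>l_i / c_i\<close>.\<close>

lemma tangent_to_confocal:
  assumes \<mu>: "\<mu> \<notin> {of_real a, of_real b}" and l: "l \<noteq> 0"
  shows "tangent_to (confocal a b \<mu>) (abs_cp2 l) \<longleftrightarrow> dual_form (confocal_diag a b \<mu>) l = 0"
proof -
  let ?c = "confocal_diag a b \<mu>"
  have c: "nondegenerate ?c" using nondegenerate_confocal[OF \<mu>] .
  have nz: "?c * u \<noteq> 0" if "u \<noteq> 0" for u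
    using c that by (auto simp: nondegenerate_def vec3_eq_iff)
  show ?thesis
  proof
    assume "tangent_to (confocal a b \<mu>) (abs_cp2 l)"
    then obtain p where p: "form ?c (rep_cp2 p) (rep_cp2 p) = 0" "abs_cp2 l = abs_cp2 (?c * rep_cp2 p)"
      by (auto simp: tangent_to_def tangent_line_def conic_points_confocal confocal_mult)
    then have "proportional (?c * rep_cp2 p) l"
      using abs_cp2_eq_iff[OF nz[OF rep_cp2_nonzero] l, of p] by simp
    then obtain k where "l = k *s (?c * rep_cp2 p)" by (auto simp: proportional_def)
    then show "dual_form ?c l = 0" using p(1) by (simp add: dual_form_scale dual_form_pole[OF c])
  next
    assume 0: "dual_form ?c l = 0"
    define q where "q = (\<chi> i. l$i / ?c$i)"
    have lq: "l = ?c * q" using c by (simp add: q_def vec3_eq_iff nondegenerate_def)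
    have q: "q \<noteq> 0" using l lq by (auto simp: vec3_eq_iff)
    obtain k where k: "k \<noteq> 0" "rep_cp2 (abs_cp2 q) = k *s q" using rep_abs_cp2[OF q] .
    have "form ?c q q = 0" using 0 unfolding lq dual_form_pole[OF c] .
    then have "abs_cp2 q \<in> conic_points (confocal a b \<mu>)"
      by (simp add: conic_points_confocal k(2) form_scale)
    moreover have "abs_cp2 l = tangent_line (confocal a b \<mu>) (abs_cp2 q)"
    proof -
      have "?c * (k *s q) = k *s l" by (simp add: lq vec3_eq_iff)
      moreover have "k *s l \<noteq> 0" using k l by simp
      ultimately show ?thesis
        using abs_cp2_eq_iff[OF l, of "k *s l"] l
        by (simp add: tangent_line_def confocal_mult k(2)) (auto simp: proportional_def)
    qed
    ultimately show "tangent_to (confocal a b \<mu>) (abs_cp2 l)" unfolding tangent_to_def by blast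
  qed
qed

text \<open>The tangents from a vertex to the caustic are the two sides at this vertex; from this property
Poncelet's construction recovers the whole polygon.\<close>

lemma n_caustic_imp_polygon:
  assumes ab: "a \<noteq> 0" "b \<noteq> 0" and \<mu>: "\<mu> \<notin> {of_real a, of_real b}" and n: "n > 0"
    and caustic: "n_caustic n (confocal a b 0) (confocal a b \<mu>)"
  obtains v where "circumscribed_polygon (confocal_diag a b \<mu>) (confocal_diag a b 0) n v"
proof -
  obtain p where orbit: "nondegenerate_orbit n (confocal a b 0) p" and circ: "circumscribed p (confocal a b \<mu>)"
    using caustic unfolding n_caustic_def by blast
  have per: "p (j + int n) = p j" and on: "p j \<in> conic_points (confocal a b 0)" and ne: "p j \<noteq> p (j + 1)" for j
    using orbit unfolding nondegenerate_orbit_def by blast+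
  have ne': "p (j - 1) \<noteq> p j" for j using ne[of "j - 1"] by simp
  have sides: "{l. tangent_to (confocal a b \<mu>) l \<and> incident (p j) l} =
      {line_through (p (j - 1)) (p j), line_through (p j) (p (j + 1))}" for j
    using circ unfolding circumscribed_def by blast
  have "circumscribed_polygon (confocal_diag a b \<mu>) (confocal_diag a b 0) n (\<lambda>j. rep_cp2 (p j))"
  proof
    show "nondegenerate (confocal_diag a b \<mu>)" using nondegenerate_confocal[OF \<mu>] .
    show "nondegenerate (confocal_diag a b 0)" using ab by (intro nondegenerate_confocal) auto
    show "n > 0" by (rule n)
    fix j :: int
    show "rep_cp2 (p (j + int n)) = rep_cp2 (p j)" by (simp add: per)
    show "rep_cp2 (p j) \<noteq> 0" by (rule rep_cp2_nonzero)
    show "form (confocal_diag a b 0) (rep_cp2 (p j)) (rep_cp2 (p j)) = 0"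
      using on[of j] by (simp add: conic_points_confocal)
    show "rep_cp2 (p j) \<noteq> rep_cp2 (p (j + 1))" using ne[of j] abs_rep_cp2 by metis
    show "rep_cp2 (p i) = rep_cp2 (p j)" if "cross (rep_cp2 (p i)) (rep_cp2 (p j)) = 0" for i
      using that line_through_eq(1)[of "p i" "p j"] by (cases "p i = p j") auto
    have "line_through (p j) (p (j + 1)) \<in> {l. tangent_to (confocal a b \<mu>) l \<and> incident (p j) l}"
      unfolding sides by simp
    then show "dual_form (confocal_diag a b \<mu>) (cross (rep_cp2 (p j)) (rep_cp2 (p (j + 1)))) = 0"
      using tangent_to_confocal[OF \<mu> line_through_eq(1)[OF ne]] line_through_eq(2)[OF ne] by simp
    fix l :: "complex^3"
    assume l: "l \<noteq> 0" "bil (rep_cp2 (p j)) l = 0" "dual_form (confocal_diag a b \<mu>) l = 0"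
    then have "abs_cp2 l \<in> {l. tangent_to (confocal a b \<mu>) l \<and> incident (p j) l}"
      by (simp add: tangent_to_confocal[OF \<mu>] incident_iff)
    then have "abs_cp2 l = line_through (p (j - 1)) (p j) \<or> abs_cp2 l = line_through (p j) (p (j + 1))"
      unfolding sides by simp
    then have "incident (p (j - 1)) (abs_cp2 l) \<or> incident (p (j + 1)) (abs_cp2 l)"
      using line_through_eq[OF ne, of j] line_through_eq[OF ne', of j] by (auto simp: incident_iff bil_cross)
    then show "bil (rep_cp2 (p (j - 1))) l = 0 \<or> bil (rep_cp2 (p (j + 1))) l = 0"
      by (simp add: incident_iff[OF l(1)])
  qed
  then show ?thesis by (rule that)
qed

text \<open>A tangent to a conic through one of its points meets it only there, so it contains no side.\<close>

lemma (in circumscribed_polygon) conics_distinct: "c \<noteq> g"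
proof
  assume "c = g"
  then obtain k where k: "cross (v 0) (v 1) = k *s (c * v 0)"
    using tangent_at_conic_point[OF c _ side_tangent bil_cross(1) nonzero, of 0] on_conic[of 0] by auto
  have s: "cross (v 0) (v 1) \<noteq> 0" using side(1)[of 0] by simp
  then have "k \<noteq> 0" using k by auto
  then have "form g (v 1) (v 0) = 0"
    using bil_cross(2)[of "v 1" "v 0"] unfolding k bil_scale form_eq_bil \<open>c = g\<close> by simp
  then have "cross (v 1) (v 0) = 0" by (intro conjugate_isotropic_imp_parallel[OF g on_conic on_conic])
  then show False using s by (subst (asm) cross_swap) simp
qed

text \<open>Two concentric circles meet only in the isotropic points at infinity.\<close>

lemma concentric_circles_not_in_general_position:
  assumes a: "a \<noteq> 0" and \<mu>: "\<mu> \<noteq> of_real a" "\<mu> \<noteq> 0"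
  shows "\<not> general_position (confocal a a 0) (confocal a a \<mu>)"
proof
  let ?S = "conic_points (confocal a a 0) \<inter> conic_points (confocal a a \<mu>)"
  assume "general_position (confocal a a 0) (confocal a a \<mu>)"
  then have "card ?S = 4" unfolding general_position_def .
  moreover have "?S \<subseteq> {hcoord 1 \<i> 0, hcoord 1 (- \<i>) 0}"
  proof
    fix p assume p: "p \<in> ?S"
    define x where "x = rep_cp2 p $ 1"
    define y where "y = rep_cp2 p $ 2"
    define z where "z = rep_cp2 p $ 3"
    define A where "A = complex_of_real a"
    have A: "A \<noteq> 0" "A - \<mu> \<noteq> 0" using a \<mu> by (auto simp: A_def)
    have scale: "x\<^sup>2 + y\<^sup>2 = B * z\<^sup>2" if "B \<noteq> 0" "1 / B * x * x + 1 / B * y * y + - 1 * z * z = 0" for B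
    proof -
      have "B * (1 / B * x * x + 1 / B * y * y + - 1 * z * z) = x\<^sup>2 + y\<^sup>2 - B * z\<^sup>2"
        using that(1) by (simp add: algebra_simps power2_eq_square)
      then show ?thesis using that(2) by simp
    qed
    have "x\<^sup>2 + y\<^sup>2 = A * z\<^sup>2" "x\<^sup>2 + y\<^sup>2 = (A - \<mu>) * z\<^sup>2"
      using p scale[of A] scale[of "A - \<mu>"] A
      unfolding conic_points_confocal Int_iff form_def confocal_diag_def x_def y_def z_def A_def
      by simp_all
    then have z0: "z = 0" and "x\<^sup>2 + y\<^sup>2 = 0" using \<mu>(2) by (auto simp: algebra_simps)
    then have "(y - \<i> * x) * (y + \<i> * x) = 0" by (simp add: power2_eq_square algebra_simps)
    then have y: "y = \<i> * x \<or> y = - \<i> * x" by (auto simp: eq_neg_iff_add_eq_0)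
    have x0: "x \<noteq> 0" using y z0 rep_cp2_nonzero[of p] by (auto simp: x_def y_def z_def vec3_eq_iff)
    have "p = hcoord 1 t 0" if "y = t * x" for t
    proof -
      have v: "vector [1, t, 0] \<noteq> (0 :: complex^3)" by (simp add: vec3_eq_iff)
      have "rep_cp2 p = x *s vector [1, t, 0]"
        using that z0 by (simp add: vec3_eq_iff x_def y_def z_def mult.commute)
      then have "proportional (vector [1, t, 0]) (rep_cp2 p)"
        using v rep_cp2_nonzero by (auto simp: proportional_def)
      then show ?thesis
        using abs_cp2_eq_iff[OF v rep_cp2_nonzero, of p] by (simp add: hcoord_def abs_rep_cp2)
    qed
    then show "p \<in> {hcoord 1 \<i> 0, hcoord 1 (- \<i>) 0}" using y by blast
  qed
  then have "card ?S \<le> card {hcoord 1 \<i> 0, hcoord 1 (- \<i>) 0}" by (intro card_mono) simp_all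
  moreover have "card {hcoord 1 \<i> 0, hcoord 1 (- \<i>) 0} \<le> 2" by (simp add: card_insert_if)
  ultimately show False by simp
qed

text \<open>The conics of the family are told apart by their intersections with the axis \<open>x = 0\<close>.\<close>

lemma conic_points_confocal_inj:
  assumes "\<mu> \<notin> {of_real a, of_real b}" "\<nu> \<notin> {of_real a, of_real b}"
    and eq: "conic_points (confocal a b \<mu>) = conic_points (confocal a b \<nu>)"
  shows "\<mu> = \<nu>"
proof -
  define y where "y = csqrt (of_real b - \<mu>)"
  have y: "y\<^sup>2 = of_real b - \<mu>" by (simp add: y_def)
  then have "hcoord 0 y 1 \<in> conic_points (confocal a b \<mu>)"
    using assms(1) by (auto simp: affine_equation_confocal)
  then have "(of_real b - \<mu>) / (of_real b - \<nu>) = 1"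
    unfolding eq by (simp add: affine_equation_confocal y)
  then show ?thesis using assms(2) by (simp add: field_simps)
qed

section \<open>Cayley polynomials and the number of n-caustics\<close>

text \<open>The coefficients in \<open>z\<close> of \<open>(1 + \<alpha> z) (1 + \<beta> z) (1 + z)\<close>, as polynomials in the caustic parameter \<open>\<mu>\<close>.\<close>

definition cubic_coeff :: "real \<Rightarrow> real \<Rightarrow> nat \<Rightarrow> complex poly" where
  "cubic_coeff a b = (let \<alpha> = [:1, - 1 / of_real a:]; \<beta> = [:1, - 1 / of_real b:] in
     coeff [:1, \<alpha> + \<beta> + 1, \<alpha> * \<beta> + \<alpha> + \<beta>, \<alpha> * \<beta>:])"

text \<open>The quotients of the diagonal entries of \<open>C\<close> by those of \<open>C_\<mu>\<close>.\<close>

definition confocal_ratio :: "real \<Rightarrow> real \<Rightarrow> complex \<Rightarrow> complex^3" where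
  "confocal_ratio a b \<mu> = vector [1 - \<mu> / of_real a, 1 - \<mu> / of_real b, 1]"

lemma degree_cubic_coeff: "degree (cubic_coeff a b k) \<le> k"
proof -
  define \<alpha> \<beta> :: "complex poly" where "\<alpha> = [:1, - 1 / of_real a:]" and "\<beta> = [:1, - 1 / of_real b:]"
  have d: "degree \<alpha> \<le> 1" "degree \<beta> \<le> 1" by (simp_all add: \<alpha>_def \<beta>_def)
  have ab: "degree (\<alpha> * \<beta>) \<le> 2" using degree_mult_le[of \<alpha> \<beta>] d by linarith
  have "degree (\<alpha> + \<beta> + 1) \<le> 1" using d by (intro degree_add_le) simp_all
  moreover have "degree (\<alpha> * \<beta> + \<alpha> + \<beta>) \<le> 2"
    using d ab by (intro degree_add_le) simp_all
  ultimately show ?thesis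
    using ab unfolding cubic_coeff_def Let_def \<alpha>_def[symmetric] \<beta>_def[symmetric]
    by (auto simp: coeff_pCons split: nat.split)
qed

lemma poly_cubic_coeff:
  "poly (cubic_coeff a b k) \<mu> = coeff [:1, esym1 (confocal_ratio a b \<mu>), esym2 (confocal_ratio a b \<mu>), esym3 (confocal_ratio a b \<mu>):] k"
  by (auto simp: cubic_coeff_def Let_def confocal_ratio_def esym1_def esym2_def esym3_def coeff_pCons algebra_simps
      split: nat.split)

text \<open>For \<open>n = 2 m + 1\<close> the matrix has size \<open>m\<close> and entries \<open>c_{m+1+i-k}\<close>, for \<open>n = 2 m\<close> it has size \<open>m - 1\<close> and
the same entries: reversing the columns gives Cayley's Hankel determinants.\<close>

definition cayley_poly :: "real \<Rightarrow> real \<Rightarrow> nat \<Rightarrow> complex poly" where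
  "cayley_poly a b n = det (toeplitz (root_coeff (cubic_coeff a b)) (n div 2) ((n - 1) div 2))"

lemma degree_cayley_poly: "degree (cayley_poly a b n) \<le> (n - 1) div 2 * Suc (n div 2)"
  unfolding cayley_poly_def
  by (intro degree_det_toeplitz degree_root_coeff degree_cubic_coeff) linarith

lemma sqrt_series:
  fixes a b \<mu>
  defines "w \<equiv> \<lambda>k. poly (root_coeff (cubic_coeff a b) k) \<mu>" and "\<alpha> \<equiv> confocal_ratio a b \<mu>"
  shows "(Abs_fps w)\<^sup>2 = fps_of_poly [:1, esym1 \<alpha>, esym2 \<alpha>, esym3 \<alpha>:]"
proof (rule fps_ext)
  fix k
  have "fps_nth ((Abs_fps w)\<^sup>2) k = (\<Sum>i\<le>k. w i * w (k - i))"
    by (simp add: power2_eq_square fps_mult_nth atLeast0AtMost)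
  also have "\<dots> = poly (\<Sum>i\<le>k. root_coeff (cubic_coeff a b) i * root_coeff (cubic_coeff a b) (k - i)) \<mu>"
    by (simp add: w_def poly_sum)
  also have "\<dots> = poly (cubic_coeff a b k) \<mu>"
    by (subst root_coeff_square) (simp_all add: cubic_coeff_def)
  finally show "fps_nth ((Abs_fps w)\<^sup>2) k = fps_nth (fps_of_poly [:1, esym1 \<alpha>, esym2 \<alpha>, esym3 \<alpha>:]) k"
    by (simp only: poly_cubic_coeff \<alpha>_def fps_of_poly_nth)
qed

lemma poly_cayley_poly:
  "poly (cayley_poly a b n) \<mu> =
    det (toeplitz (\<lambda>k. poly (root_coeff (cubic_coeff a b) k) \<mu>) (n div 2) ((n - 1) div 2))"
  unfolding cayley_poly_def by (rule poly_det_toeplitz)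

text \<open>At \<open>\<mu> = 0\<close> the conics coincide and \<open>D = (1 + z)\<^sup>3\<close>.\<close>

lemma cayley_poly_0:
  assumes "n \<noteq> 0"
  shows "poly (cayley_poly a b n) 0 \<noteq> 0"
  unfolding poly_cayley_poly
proof (rule toeplitz_cube_regular[OF assms])
  have "[:1, esym1 (confocal_ratio a b 0), esym2 (confocal_ratio a b 0), esym3 (confocal_ratio a b 0):] = [:1, 1:] ^ 3"
    by (simp add: confocal_ratio_def esym1_def esym2_def esym3_def eval_nat_numeral)
  then show "(Abs_fps (\<lambda>k. poly (root_coeff (cubic_coeff a b) k) 0))\<^sup>2 = fps_of_poly ([:1, 1:] ^ 3)"
    using sqrt_series[of a b 0] by simp
qed

text \<open>Necessity of Cayley's condition. The Pell equation of the polygon needs the three ratios \<open>\<alpha>_i\<close> to be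
nonzero and distinct; the latter excludes \<open>\<mu> = 0\<close>, where the two conics agree, and \<open>a = b\<close>, where
they are concentric circles.\<close>

theorem n_caustic_imp_cayley:
  assumes ab: "a \<noteq> 0" "b \<noteq> 0" and \<mu>: "\<mu> \<notin> {of_real a, of_real b}" and n: "n > 0"
    and caustic: "n_caustic n (confocal a b 0) (confocal a b \<mu>)"
  shows "poly (cayley_poly a b n) \<mu> = 0"
proof -
  let ?\<alpha> = "confocal_ratio a b \<mu>"
  obtain v where "circumscribed_polygon (confocal_diag a b \<mu>) (confocal_diag a b 0) n v"
    using n_caustic_imp_polygon[OF ab \<mu> n caustic] .
  then interpret circumscribed_polygon "confocal_diag a b \<mu>" "confocal_diag a b 0" n v .
  have \<mu>0: "\<mu> \<noteq> 0" using conics_distinct by auto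
  have "a \<noteq> b"
    using caustic concentric_circles_not_in_general_position[OF ab(1), of \<mu>] \<mu> \<mu>0
    unfolding n_caustic_def by auto
  have nz: "complex_of_real a - \<mu> \<noteq> 0" "complex_of_real b - \<mu> \<noteq> 0" using \<mu> by auto
  have \<alpha>: "confocal_diag a b 0 = ?\<alpha> * confocal_diag a b \<mu>"
    using nz ab by (simp add: confocal_diag_def confocal_ratio_def vec3_eq_iff field_simps)
  have "1 - \<mu> / of_real a \<noteq> 0" "1 - \<mu> / of_real b \<noteq> 0" using nz ab by (auto simp: field_simps)
  then have e: "esym3 ?\<alpha> \<noteq> 0" by (simp add: confocal_ratio_def esym3_def)
  have d: "weight_prod ?\<alpha> \<noteq> 0" using \<mu>0 ab \<open>a \<noteq> b\<close> by (simp add: weight_prod_def base_weight_def confocal_ratio_def field_simps)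
  obtain P Q k where "k \<noteq> 0" "P\<^sup>2 - Q\<^sup>2 * [:1, esym1 ?\<alpha>, esym2 ?\<alpha>, esym3 ?\<alpha>:] = monom k n" "poly P 0 \<noteq> poly Q 0"
    using pell[OF \<alpha> d e] .
  then show ?thesis
    unfolding poly_cayley_poly using n e
    by (intro pell_imp_toeplitz_singular[OF _ _ _ _ _ _ sqrt_series]) auto
qed

theorem card_n_caustics:
  fixes a b :: real and n :: nat
  assumes "a \<noteq> 0" "b \<noteq> 0" "n > 0"
  defines "R \<equiv> {\<mu>. \<mu> \<notin> {of_real a, of_real b} \<and> n_caustic n (confocal a b 0) (confocal a b \<mu>)}"
  shows "finite R" and "card R \<le> (n - 1) div 2 * Suc (n div 2)"
proof -
  have C: "cayley_poly a b n \<noteq> 0" using cayley_poly_0[of n a b] assms(3) by auto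
  have sub: "R \<subseteq> {\<mu>. poly (cayley_poly a b n) \<mu> = 0}"
    using n_caustic_imp_cayley[OF assms(1,2) _ assms(3)] unfolding R_def by blast
  have fin: "finite {\<mu>. poly (cayley_poly a b n) \<mu> = 0}" using C by (rule poly_roots_finite)
  show "finite R" using sub fin by (rule finite_subset)
  have "card R \<le> card {\<mu>. poly (cayley_poly a b n) \<mu> = 0}" using fin sub by (rule card_mono)
  also have "\<dots> \<le> degree (cayley_poly a b n)" using C by (rule card_poly_roots_bound)
  also have "\<dots> \<le> (n - 1) div 2 * Suc (n div 2)" by (rule degree_cayley_poly)
  finally show "card R \<le> (n - 1) div 2 * Suc (n div 2)" .
qed

theorem proposition2p21:
  fixes a b :: real and n :: nat
  assumes "a \<noteq> 0" and "b \<noteq> 0" and "n \<ge> 3"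
  shows "\<exists>B :: complex poly.
    (\<forall>\<mu>. \<mu> \<notin> {of_real a, of_real b} \<longrightarrow>
       (poly B \<mu> = 0 \<longleftrightarrow> n_caustic n (confocal a b 0) (confocal a b \<mu>))) \<and>
    (odd n \<longrightarrow> real (degree B) \<le> (real n ^ 2 - 1) / 4) \<and>
    (even n \<longrightarrow> real (degree B) \<le> real n ^ 2 / 4 - 1) \<and>
    (rsquarefree B \<and> (\<forall>\<mu>. poly B \<mu> = 0 \<longrightarrow> \<mu> \<noteq> of_real a \<and> \<mu> \<noteq> of_real b) \<longrightarrow>
       num_caustics a b n = degree B)"
proof -
  define R where "R = {\<mu>. \<mu> \<notin> {complex_of_real a, complex_of_real b} \<and>
    n_caustic n (confocal a b 0) (confocal a b \<mu>)}"
  have "n > 0" using assms(3) by simp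
  note card_n_caustics[OF assms(1,2) \<open>n > 0\<close>, folded R_def]
  then have fin: "finite R" and card: "card R \<le> (n - 1) div 2 * Suc (n div 2)" by blast+
  define B where "B = (\<Prod>\<mu>\<in>R. [:- \<mu>, 1:])"
  have roots: "poly B \<mu> = 0 \<longleftrightarrow> \<mu> \<in> R" for \<mu> using fin by (simp add: B_def poly_prod)
  have deg: "degree B = card R" by (simp add: B_def degree_prod_sum_eq)
  have "num_caustics a b n = card ((\<lambda>\<mu>. conic_points (confocal a b \<mu>)) ` R)"
    unfolding num_caustics_def R_def by (rule arg_cong[of _ _ card]) blast
  also have "\<dots> = card R"
    by (rule card_image) (auto simp: R_def intro!: inj_onI dest: conic_points_confocal_inj[rotated 2])
  finally have num: "num_caustics a b n = degree B" by (simp add: deg)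
  have "real (degree B) \<le> (real n ^ 2 - 1) / 4" if "odd n"
  proof -
    obtain m where m: "n = 2 * m + 1" using \<open>odd n\<close> by (rule oddE)
    have "real (degree B) \<le> real (m * Suc m)" unfolding deg of_nat_le_iff using card by (simp add: m)
    also have "\<dots> = (real n ^ 2 - 1) / 4" by (simp add: m power2_eq_square field_simps)
    finally show ?thesis .
  qed
  moreover have "real (degree B) \<le> real n ^ 2 / 4 - 1" if "even n"
  proof -
    obtain m where m: "n = 2 * m" using \<open>even n\<close> by (rule evenE)
    have "(n - 1) div 2 = m - 1" "m \<ge> 1" using m assms(3) by linarith+
    then have "real (degree B) \<le> real ((m - 1) * Suc m)" unfolding deg of_nat_le_iff using card by (simp add: m)
    also have "\<dots> = real n ^ 2 / 4 - 1"
      using \<open>m \<ge> 1\<close> by (simp add: m power2_eq_square of_nat_diff algebra_simps)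
    finally show ?thesis .
  qed
  ultimately show ?thesis using roots num unfolding R_def by (intro exI[of _ B]) auto
qed

end
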